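(* Let $X$ and $Y$ be connected topological manifolds of equal dimensions, with $X$ compact. Let $f\colon X\to Y$ be a continuous mapping such that $f(\partial X)\subseteq \partial Y$ and such that $f|_{\partial X}$ and $f|_{X\setminus\partial X}$ are immersions. Suppose that $X$ and $Y$ have nonempty boundaries with the same number of connected components, and that at least one of the connected components of $\partial Y$ is simply connected. Then $f$ is a homeomorphism of $X$ onto $Y$.
   Context: An $n$-dimensional topological manifold is a Hausdorff topological space having a countable cover by open sets each of which is homeomorphic either to $\mathbb{R}^n$ or to the half-space $\mathbb{R}^n_+=\{(x_1,\ldots,x_n) : x_i\in\mathbb{R},\ x_1\ge 0\}$. Points having a neighborhood homeomorphic to $\mathbb{R}^n$ are interior points; the boundary $\partial X$ is the subspace of points that are not interior. A continuous mapping $g\colon A\to B$ of topological spaces is called an immersion if every point $a\in A$ has a neighborhood $U$ in $A$ such that $g|_U$ is a homeomorphism of $U$ onto $g(U)$. In particular, "$f|_{\partial X}$ is an immersion" refers to neighborhoods in $\partial X$, not in $X$. *)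

theory Defs
  imports "HOL-Analysis.Analysis"
begin

text \<open>Coordinates in \<^const>\<open>Euclidean_space\<close> are indexed from \<open>0\<close>, so the distinguished
  coordinate of the half-space is \<open>x 0\<close>. For \<open>n = 0\<close> this is a single point, the same space as
  \<^term>\<open>Euclidean_space 0\<close>.\<close>

definition half_space :: "nat \<Rightarrow> (nat \<Rightarrow> real) topology" where
  "half_space n = subtopology (Euclidean_space n) {x. 0 \<le> x 0}"

definition topological_manifold :: "nat \<Rightarrow> 'a topology \<Rightarrow> bool" where
  "topological_manifold n X \<longleftrightarrow>
     Hausdorff_space X \<and>
     (\<exists>\<U>. countable \<U> \<and> \<Union>\<U> = topspace X \<and>
        (\<forall>U\<in>\<U>. openin X U \<and>
           (subtopology X U homeomorphic_space Euclidean_space n \<or>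
            subtopology X U homeomorphic_space half_space n)))"

definition manifold_interior :: "nat \<Rightarrow> 'a topology \<Rightarrow> 'a set" where
  "manifold_interior n X =
     {x \<in> topspace X. \<exists>U. openin X U \<and> x \<in> U \<and>
        subtopology X U homeomorphic_space Euclidean_space n}"

definition manifold_boundary :: "nat \<Rightarrow> 'a topology \<Rightarrow> 'a set" where
  "manifold_boundary n X = topspace X - manifold_interior n X"

text \<open>An immersion in the topological sense, not a smooth one. Neighbourhoods are those of the
  domain \<open>A\<close>, so for the restriction of a map to a subspace, \<open>A\<close> is to be that subspace.\<close>

definition topological_immersion :: "'a topology \<Rightarrow> 'b topology \<Rightarrow> ('a \<Rightarrow> 'b) \<Rightarrow> bool" where
  "topological_immersion A B g \<longleftrightarrow>
     continuous_map A B g \<and>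
     (\<forall>a\<in>topspace A. \<exists>U. openin A U \<and> a \<in> U \<and>
        homeomorphic_map (subtopology A U) (subtopology B (g ` U)) g)"

text \<open>\<^const>\<open>simply_connected\<close> is only available for subsets of types of class
  \<^class>\<open>topological_space\<close>. For an abstract topology: path-connected, with every loop
  null-homotopic relative to its base point.\<close>

definition simply_connected_space :: "'a topology \<Rightarrow> bool" where
  "simply_connected_space X \<longleftrightarrow>
     path_connected_space X \<and>
     (\<forall>p. pathin X p \<and> p 0 = p 1 \<longrightarrow>
        homotopic_with (\<lambda>q. q 0 = p 0 \<and> q 1 = p 0) (top_of_set {0..1}) X p (\<lambda>t. p 0))"

end

theory Submission
  imports Defs "HOL-Homology.Invariance_of_Domain"
begin

text \<open>
  The map \<open>f\<close> behaves like a finite covering, and the simply connected boundary component forces it to have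
  a single sheet.

  By invariance of domain \<open>f\<close> maps the interior of \<open>X\<close> into the interior of \<open>Y\<close>, and the boundary into the
  boundary by hypothesis. Both restrictions are therefore open, locally injective and, since \<open>X\<close> is compact,
  proper: they are proper local homeomorphisms between manifolds without boundary. The interior of \<open>Y\<close> is
  connected, so the interior part of \<open>f\<close> is onto, and by density and compactness so are \<open>f\<close> and its
  boundary part.

  Hence \<open>f\<close> maps the finitely many components of the boundary of \<open>X\<close> onto those of the boundary of \<open>Y\<close>; as
  there are equally many, the points over the simply connected component lie in one component. Homotopy
  lifting (\<open>proper_local_homeo_monodromy\<close>) then shows that a point \<open>y\<close> of the simply connected component has
  only one preimage \<open>x\<close>. Near \<open>y\<close> the interior of \<open>Y\<close> looks like a convex half-ball, which is simply
  connected, and nearby interior points have all their preimages near \<open>x\<close>, where they can be joined by a path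
  in the interior. The same lifting argument shows that such a point has only one preimage
  in the interior. The number of interior preimages being at most one is both an open and a closed condition
  (\<open>proper_local_homeo_inj_if_singleton_fibre\<close>), so \<open>f\<close> is injective on the whole interior.

  Finally, two distinct boundary points over the same \<open>y'\<close> would split the preimage of the interior part of a
  small half-ball at \<open>y'\<close> into two disjoint nonempty open pieces, although \<open>f\<close> maps this preimage
  homeomorphically onto a connected set. So \<open>f\<close> is a continuous bijection from a compact space to a Hausdorff
  space.
\<close>

section \<open>Lifting through proper local homeomorphisms\<close>

definition locally_injective :: "'a topology \<Rightarrow> ('a \<Rightarrow> 'b) \<Rightarrow> bool" where
  "locally_injective A g \<longleftrightarrow> (\<forall>a\<in>topspace A. \<exists>U. openin A U \<and> a \<in> U \<and> inj_on g U)"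

text \<open>The agreement set of the two lifts is closed because \<open>E\<close> is Hausdorff and open because
  \<open>p\<close> is locally injective.\<close>

lemma lift_unique:
  assumes E: "Hausdorff_space E" "locally_injective E p"
    and Z: "connected_space Z" "z0 \<in> topspace Z" "z \<in> topspace Z"
    and s: "continuous_map Z E s" and t: "continuous_map Z E t"
    and eq: "\<And>z. z \<in> topspace Z \<Longrightarrow> p (s z) = p (t z)" and z0: "s z0 = t z0"
  shows "s z = t z"
proof -
  define D where "D = {z \<in> topspace Z. s z = t z}"
  have "openin Z D"
  proof (subst openin_subopen, intro ballI)
    fix z assume z: "z \<in> D"
    then have "z \<in> topspace Z" by (simp add: D_def)
    then have "s z \<in> topspace E"
      using continuous_map_image_subset_topspace[OF s] by blast
    then obtain U where U: "openin E U" "s z \<in> U" "inj_on p U"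
      using E(2) by (auto simp: locally_injective_def)
    define V where "V = {w \<in> topspace Z. s w \<in> U} \<inter> {w \<in> topspace Z. t w \<in> U}"
    have "openin Z V"
      unfolding V_def using U(1) s t by (intro openin_Int openin_continuous_map_preimage) auto
    moreover have "V \<subseteq> D"
      using U(3) eq by (auto simp: V_def D_def inj_on_def)
    moreover have "z \<in> V"
      using z U(2) by (auto simp: V_def D_def)
    ultimately show "\<exists>T. openin Z T \<and> z \<in> T \<and> T \<subseteq> D" by blast
  qed
  moreover have "closedin Z D"
    unfolding D_def using closedin_continuous_maps_eq[OF E(1) s t] .
  moreover have "z0 \<in> D" using Z z0 by (simp add: D_def)
  ultimately have "D = topspace Z"
    using Z(1) unfolding connected_space_clopen_in by blast
  then show ?thesis using Z(3) by (auto simp: D_def)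
qed

lemma continuous_map_local_section:
  assumes p: "open_map E B p" and U: "openin E U" "inj_on p U"
  shows "continuous_map (subtopology B (p ` U)) E (inv_into U p)"
  unfolding continuous_map_def
proof (intro conjI allI impI)
  have UE: "U \<subseteq> topspace E" using U openin_subset by blast
  have pU: "openin B (p ` U)" using p U by (auto simp: open_map_def)
  show "inv_into U p \<in> topspace (subtopology B (p ` U)) \<rightarrow> topspace E"
      proof
    fix y assume "y \<in> topspace (subtopology B (p ` U))"
    then have "y \<in> p ` U" by simp
    then show "inv_into U p y \<in> topspace E" using UE inv_into_into[of y p U] by blast
  qed
  fix W assume W: "openin E W"
  have "{y \<in> topspace (subtopology B (p ` U)). inv_into U p y \<in> W} = p ` (U \<inter> W)"
    using U(2) openin_subset[OF pU] by (auto simp: inv_into_f_f)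
  moreover have "openin B (p ` (U \<inter> W))"
    using p U W by (auto simp: open_map_def)
  ultimately show "openin (subtopology B (p ` U)) {y \<in> topspace (subtopology B (p ` U)). inv_into U p y \<in> W}"
    using pU by (auto simp: openin_open_subtopology)
qed

text \<open>The fibre over \<open>b\<close> is compact, so finitely many open sets on which \<open>p\<close> is injective cover it; their
  images are open, and since \<open>p\<close> is closed, all points over a small enough neighbourhood of \<open>b\<close> lie
  in these sets. Formulating even covering as "a section through every point" avoids making the
  sheets disjoint.\<close>

lemma proper_local_homeo_evenly_covered:
  assumes p: "proper_map E B p" "open_map E B p" "locally_injective E p"
    and b: "b \<in> topspace B"
  obtains N where "openin B N" "b \<in> N"
    "\<And>e. e \<in> topspace E \<Longrightarrow> p e \<in> N \<Longrightarrow>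
      \<exists>s. continuous_map (subtopology B N) E s \<and> (\<forall>y\<in>N. p (s y) = y) \<and> s (p e) = e"
proof -
  define F where "F = {e \<in> topspace E. p e = b}"
  have "compactin E F"
    using p(1) b by (auto simp: proper_map_def F_def)
  moreover have "F \<subseteq> \<Union>{U. openin E U \<and> inj_on p U}"
    using p(3) by (fastforce simp: F_def locally_injective_def)
  ultimately obtain \<F> where \<F>: "finite \<F>" "\<F> \<subseteq> {U. openin E U \<and> inj_on p U}" "F \<subseteq> \<Union>\<F>"
    unfolding compactin_def by (metis (no_types, lifting) mem_Collect_eq)
  define \<G> where "\<G> = {U \<in> \<F>. b \<in> p ` U}"
  have \<G>: "finite \<G>" "\<And>U. U \<in> \<G> \<Longrightarrow> openin E U" "\<And>U. U \<in> \<G> \<Longrightarrow> inj_on p U"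
     "\<And>U. U \<in> \<G> \<Longrightarrow> b \<in> p ` U" "F \<subseteq> \<Union>\<G>"
  proof -
    show "F \<subseteq> \<Union>\<G>"
    proof
      fix e assume e: "e \<in> F"
      then obtain U where "U \<in> \<F>" "e \<in> U" using \<F>(3) by blast
      then show "e \<in> \<Union>\<G>" using e unfolding \<G>_def F_def by blast
    qed
  qed (use \<F> in \<open>auto simp: \<G>_def\<close>)
  have "openin E (\<Union>\<G>)" using \<G>(2) by blast
  then obtain V where V: "openin B V" "b \<in> V" "{e \<in> topspace E. p e \<in> V} \<subseteq> \<Union>\<G>"
    using p(1) b \<G>(5) unfolding proper_map_def closed_map_fibre_neighbourhood F_def by meson
  define N where "N = \<Inter>(insert V ((`) p ` \<G>))"
  show thesis
  proof
    show "openin B N"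
      unfolding N_def using V(1) \<G>(1,2) p(2)
      by (intro openin_Inter) (auto simp: open_map_def)
    show "b \<in> N" using V(2) \<G>(4) by (auto simp: N_def)
    fix e assume e: "e \<in> topspace E" "p e \<in> N"
    then obtain U where U: "U \<in> \<G>" "e \<in> U"
      using V(3) by (auto simp: N_def)
    have NU: "N \<subseteq> p ` U" using U(1) by (auto simp: N_def)
    have "continuous_map (subtopology B (p ` U)) E (inv_into U p)"
      using continuous_map_local_section p(2) \<G>(2,3) U(1) by blast
    then have "continuous_map (subtopology B N) E (inv_into U p)"
      using NU by (rule continuous_map_from_subtopology_mono)
    moreover have "\<forall>y\<in>N. p (inv_into U p y) = y"
      using NU by (auto intro: f_inv_into_f)
    moreover have "inv_into U p (p e) = e"
      using \<G>(3) U by (auto simp: inv_into_f_f)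
    ultimately show "\<exists>s. continuous_map (subtopology B N) E s \<and> (\<forall>y\<in>N. p (s y) = y) \<and> s (p e) = e"
      by blast
  qed
qed

text \<open>Quantifying over the base point \<open>a\<close>, along with its prescribed lift \<open>e\<close>, makes the property pass to
  subsets and survive gluing.\<close>

definition lifts_over ::
    "'e topology \<Rightarrow> ('e \<Rightarrow> 'b) \<Rightarrow> ('z::topological_space \<Rightarrow> 'b) \<Rightarrow> 'z set \<Rightarrow> bool" where
  "lifts_over E p h A \<longleftrightarrow> (\<forall>a\<in>A. \<forall>e\<in>topspace E. p e = h a \<longrightarrow>
     (\<exists>s. continuous_map (top_of_set A) E s \<and> (\<forall>z\<in>A. p (s z) = h z) \<and> s a = e))"

lemma lifts_over_subset:
  assumes "lifts_over E p h A" "A' \<subseteq> A"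
  shows "lifts_over E p h A'"
  using assms unfolding lifts_over_def
  by (meson continuous_map_from_subtopology_mono subsetD)

text \<open>Two lifts that agree at one point of the connected overlap agree on all of it, so they can be pasted.\<close>

lemma lifts_over_Un:
  fixes S T :: "'z::topological_space set"
  assumes E: "Hausdorff_space E" "locally_injective E p"
    and S: "closed S" "lifts_over E p h S" and T: "closed T" "lifts_over E p h T"
    and ST: "connected (S \<inter> T)" "S \<inter> T \<noteq> {}"
  shows "lifts_over E p h (S \<union> T)"
proof -
  have half: "\<exists>s. continuous_map (top_of_set (S \<union> T)) E s \<and> (\<forall>z\<in>S \<union> T. p (s z) = h z) \<and> s a = e"
    if prems: "a \<in> S" "e \<in> topspace E" "p e = h a"
      "closed S" "lifts_over E p h S" "closed T" "lifts_over E p h T" 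
      "connected (S \<inter> T)" "S \<inter> T \<noteq> {}" for a e and S T :: "'z set"
  proof -
    obtain s where s: "continuous_map (top_of_set S) E s" "\<forall>z\<in>S. p (s z) = h z" "s a = e"
      using prems(1-3,5) unfolding lifts_over_def by blast
    obtain c where c: "c \<in> S" "c \<in> T" using prems(9) by blast
    have "s c \<in> topspace E" using s(1) c by (auto simp: continuous_map_def)
    then obtain t where t: "continuous_map (top_of_set T) E t" "\<forall>z\<in>T. p (t z) = h z" "t c = s c"
      using prems(7) c s(2) unfolding lifts_over_def by metis
    have st: "s z = t z" if "z \<in> S \<inter> T" for z
    proof (rule lift_unique[OF E, of "top_of_set (S \<inter> T)" c])
      show "continuous_map (top_of_set (S \<inter> T)) E s" "continuous_map (top_of_set (S \<inter> T)) E t"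
        using s(1) t(1) by (auto intro: continuous_map_from_subtopology_mono)
      show "connected_space (top_of_set (S \<inter> T))"
        using prems(8) by (simp flip: connectedin_iff_connected add: connectedin_def)
    qed (use that c s t in auto)
    define u where "u = (\<lambda>z. if z \<in> S then s z else t z)"
    have "continuous_map (top_of_set (S \<union> T)) E u"
    proof (rule pasting_lemma_closed[where I = "UNIV :: bool set"
          and T = "\<lambda>b. if b then S else T" and f = "\<lambda>b. if b then s else t"])
      fix i :: bool
      show "closedin (top_of_set (S \<union> T)) (if i then S else T)"
        using prems by (auto intro: closed_subset)
      show "continuous_map (subtopology (top_of_set (S \<union> T)) (if i then S else T)) E (if i then s else t)"
        using s(1) t(1) by (auto simp: subtopology_subtopology Int_absorb1)
    qed (use st in \<open>auto simp: u_def\<close>)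
    moreover have "\<forall>z\<in>S \<union> T. p (u z) = h z" using s t by (auto simp: u_def)
    moreover have "u a = e" using prems(1) s by (simp add: u_def)
    ultimately show ?thesis by blast
  qed
  show ?thesis
    unfolding lifts_over_def
  proof (intro ballI impI)
    fix a e assume "a \<in> S \<union> T" and e: "e \<in> topspace E" "p e = h a"
    then consider "a \<in> S" | "a \<in> T" by blast
    then show "\<exists>s. continuous_map (top_of_set (S \<union> T)) E s \<and> (\<forall>z\<in>S \<union> T. p (s z) = h z) \<and> s a = e"
    proof cases
      case 1 then show ?thesis using half[where a = a and e = e and S = S and T = T] e assms by auto
    next
      case 2 then show ?thesis using half[where a = a and e = e and S = T and T = S] e assms by (auto simp: Un_commute Int_commute)
    qed
  qed
qed

text \<open>Compactness of the square is used through bisection, one coordinate at a time: over small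
  rectangles lifts come from local sections, these are glued along the second coordinate to give thin
  strips, and the strips are glued along the first coordinate. Every overlap is a segment, which is
  what the gluing lemma requires.\<close>

lemma lifts_over_square:
  fixes h :: "real \<times> real \<Rightarrow> 'b"
  assumes E: "Hausdorff_space E"
    and p: "proper_map E B p" "open_map E B p" "locally_injective E p"
    and h: "continuous_map (top_of_set ({0..1} \<times> {0..1})) B h"
  shows "lifts_over E p h ({0..1} \<times> {0..1})"
proof -
  let ?Q = "{0..1::real} \<times> {0..1::real}"
  have loc: "\<exists>d>0. \<forall>A\<subseteq>?Q. (\<forall>(x,y)\<in>A. \<bar>x - t\<bar> < d \<and> \<bar>y - u\<bar> < d) \<longrightarrow> lifts_over E p h A"
    if tu: "(t,u) \<in> ?Q" for t u
  proof -
    have "h (t,u) \<in> topspace B" using h tu by (auto simp: continuous_map_def)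
    then obtain N where N: "openin B N" "h (t,u) \<in> N"
      and sec: "\<And>e. e \<in> topspace E \<Longrightarrow> p e \<in> N \<Longrightarrow>
        \<exists>s. continuous_map (subtopology B N) E s \<and> (\<forall>y\<in>N. p (s y) = y) \<and> s (p e) = e"
      using proper_local_homeo_evenly_covered[OF p] by metis
    have "openin (top_of_set ?Q) {z \<in> ?Q. h z \<in> N}"
      using openin_continuous_map_preimage[OF h N(1)] by simp
    then obtain S where S: "open S" "{z \<in> ?Q. h z \<in> N} = ?Q \<inter> S"
      by (auto simp: openin_open)
    have "(t,u) \<in> S" using S(2) tu N(2) by blast
    then obtain d where d: "d > 0" "ball (t,u) d \<subseteq> S"
      using S(1) openE by blast
    have "lifts_over E p h A"
      if A: "A \<subseteq> ?Q" "\<forall>(x,y)\<in>A. \<bar>x - t\<bar> < d/2 \<and> \<bar>y - u\<bar> < d/2" for A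
      unfolding lifts_over_def
    proof (intro ballI impI)
      have "A \<subseteq> S"
      proof
        fix z assume z: "z \<in> A"
        obtain x y where xy: "z = (x,y)" by fastforce
        have "dist (t,u) z \<le> \<bar>x - t\<bar> + \<bar>y - u\<bar>"
          using sqrt_sum_squares_le_sum_abs[of "x - t" "y - u"]
          by (simp add: xy dist_Pair_Pair dist_real_def power2_commute abs_minus_commute)
        also have "\<dots> < d" using A(2) z xy by fastforce
        finally show "z \<in> S" using d(2) by auto
      qed
      then have hN: "h z \<in> N" if "z \<in> A" for z using that A(1) S(2) by blast
      fix a e assume a: "a \<in> A" "e \<in> topspace E" "p e = h a"
      then obtain s where s: "continuous_map (subtopology B N) E s" "\<forall>y\<in>N. p (s y) = y" "s (p e) = e"
        using sec[of e] hN by metis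
      have "continuous_map (top_of_set A) B h"
        using h A(1) by (rule continuous_map_from_subtopology_mono)
      then have "continuous_map (top_of_set A) (subtopology B N) h"
        using hN by (simp add: continuous_map_in_subtopology)
      then have "continuous_map (top_of_set A) E (s \<circ> h)"
        using s(1) continuous_map_compose by blast
      then show "\<exists>s. continuous_map (top_of_set A) E s \<and> (\<forall>z\<in>A. p (s z) = h z) \<and> s a = e"
        using s(2,3) hN a by (intro exI[of _ "s \<circ> h"]) auto
    qed
    then show ?thesis using d(1) half_gt_zero by blast
  qed
  have strip: "\<exists>d>0. lifts_over E p h (({t-d..t+d} \<inter> {0..1}) \<times> {0..1})" if t: "t \<in> {0..1}" for t
  proof -
    \<comment> \<open>The bisection predicate carries a guard that confines its intervals to the unit interval; the
      premise here is that guard for the endpoints \<open>0\<close> and \<open>1\<close>.\<close>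
    have "0 \<le> (0::real) \<and> (0::real) \<le> 1 \<and> (1::real) \<le> 1 \<longrightarrow>
      (\<exists>d>0. lifts_over E p h (({t-d..t+d} \<inter> {0..1}) \<times> {0..1}))"
    proof (rule Bolzano[where a = "0::real" and b = 1 and P = "\<lambda>c e. 0 \<le> c \<and> c \<le> e \<and> e \<le> 1 \<longrightarrow>
      (\<exists>d>0. lifts_over E p h (({t-d..t+d} \<inter> {0..1}) \<times> {c..e}))"])
      fix a b c :: real
      assume trans: "0 \<le> a \<and> a \<le> b \<and> b \<le> 1 \<longrightarrow>
          (\<exists>d>0. lifts_over E p h (({t-d..t+d} \<inter> {0..1}) \<times> {a..b}))"
        "0 \<le> b \<and> b \<le> c \<and> c \<le> 1 \<longrightarrow>
          (\<exists>d>0. lifts_over E p h (({t-d..t+d} \<inter> {0..1}) \<times> {b..c}))" "a \<le> b" "b \<le> c"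
      show "0 \<le> a \<and> a \<le> c \<and> c \<le> 1 \<longrightarrow>
          (\<exists>d>0. lifts_over E p h (({t-d..t+d} \<inter> {0..1}) \<times> {a..c}))"
      proof
        assume abc: "0 \<le> a \<and> a \<le> c \<and> c \<le> 1"
        obtain d1 d2 where d: "d1 > 0" "d2 > 0"
            "lifts_over E p h (({t-d1..t+d1} \<inter> {0..1}) \<times> {a..b})"
            "lifts_over E p h (({t-d2..t+d2} \<inter> {0..1}) \<times> {b..c})"
          using trans abc by force
        define d where "d = min d1 d2"
        let ?I = "{t-d..t+d} \<inter> {0..1}"
        have "lifts_over E p h (?I \<times> {a..b})" "lifts_over E p h (?I \<times> {b..c})"
          by (rule lifts_over_subset[OF d(3)], auto simp: d_def)
             (rule lifts_over_subset[OF d(4)], auto simp: d_def)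
        moreover have "(?I \<times> {a..b}) \<inter> (?I \<times> {b..c}) = ?I \<times> {b}"
          using trans(3,4) by auto
        moreover have "connected (?I \<times> {b})"
          by (intro connected_Times convex_connected convex_Int convex_real_interval) auto
        moreover have "?I \<times> {b} \<noteq> {}"
          using t d by (auto simp: d_def intro!: exI[of _ t])
        ultimately have "lifts_over E p h (?I \<times> {a..b} \<union> ?I \<times> {b..c})"
          by (intro lifts_over_Un E p) (auto intro!: closed_Times)
        moreover have "?I \<times> {a..b} \<union> ?I \<times> {b..c} = ?I \<times> {a..c}"
          using trans(3,4) by auto
        ultimately show "\<exists>d>0. lifts_over E p h (({t-d..t+d} \<inter> {0..1}) \<times> {a..c})"
          using d by (intro exI[of _ d]) (auto simp: d_def)
      qed
    next
      fix u :: real assume "0 \<le> u" "u \<le> 1"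
      then obtain d where d: "d > 0"
        "\<forall>A\<subseteq>?Q. (\<forall>(x,y)\<in>A. \<bar>x - t\<bar> < d \<and> \<bar>y - u\<bar> < d) \<longrightarrow> lifts_over E p h A"
        using loc[of t u] t by auto
      have "lifts_over E p h (({t-d/2..t+d/2} \<inter> {0..1}) \<times> {a..b})"
        if "a \<le> u" "u \<le> b" "b - a < d" "0 \<le> a" "b \<le> 1" for a b
      proof -
        have "\<bar>x - t\<bar> < d" if "t - d/2 \<le> x" "x \<le> t + d/2" for x
          using that d(1) by linarith
        moreover have "\<bar>y - u\<bar> < d" if "a \<le> y" "y \<le> b" for y
          using that \<open>a \<le> u\<close> \<open>u \<le> b\<close> \<open>b - a < d\<close> by linarith
        ultimately show ?thesis
          using that by (intro d(2)[rule_format]) auto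
      qed
      then show "\<exists>d>0. \<forall>a b. a \<le> u \<and> u \<le> b \<and> b - a < d \<longrightarrow> 0 \<le> a \<and> a \<le> b \<and> b \<le> 1 \<longrightarrow>
          (\<exists>d>0. lifts_over E p h (({t-d..t+d} \<inter> {0..1}) \<times> {a..b}))"
        using d(1) half_gt_zero by blast
    qed simp
    then show ?thesis by simp
  qed
  have "0 \<le> (0::real) \<and> (0::real) \<le> 1 \<and> (1::real) \<le> 1 \<longrightarrow> lifts_over E p h ?Q"
  proof (rule Bolzano[where a = "0::real" and b = 1 and P = "\<lambda>a b. 0 \<le> a \<and> a \<le> b \<and> b \<le> 1 \<longrightarrow>
      lifts_over E p h ({a..b} \<times> {0..1})"])
    fix a b c :: real
    assume trans: "0 \<le> a \<and> a \<le> b \<and> b \<le> 1 \<longrightarrow> lifts_over E p h ({a..b} \<times> {0..1})"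
      "0 \<le> b \<and> b \<le> c \<and> c \<le> 1 \<longrightarrow> lifts_over E p h ({b..c} \<times> {0..1})" "a \<le> b" "b \<le> c"
    show "0 \<le> a \<and> a \<le> c \<and> c \<le> 1 \<longrightarrow> lifts_over E p h ({a..c} \<times> {0..1})"
    proof
      assume abc: "0 \<le> a \<and> a \<le> c \<and> c \<le> 1"
      have "lifts_over E p h ({a..b} \<times> {0..1})" "lifts_over E p h ({b..c} \<times> {0..1})"
        using trans abc by force+
      moreover have "({a..b} \<times> {0..1}) \<inter> ({b..c} \<times> {0..1}) = {b} \<times> {0..1::real}"
        using trans(3,4) by auto
      moreover have "connected ({b} \<times> {0..1::real})"
        by (intro connected_Times) auto
      ultimately have "lifts_over E p h ({a..b} \<times> {0..1} \<union> {b..c} \<times> {0..1})"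
        by (intro lifts_over_Un E p) (auto intro!: closed_Times)
      moreover have "{a..b} \<times> {0..1} \<union> {b..c} \<times> {0..1} = {a..c} \<times> {0..1::real}"
        using trans(3,4) by auto
      ultimately show "lifts_over E p h ({a..c} \<times> {0..1})" by simp
    qed
  next
    fix t :: real assume "0 \<le> t" "t \<le> 1"
    then obtain d where d: "d > 0" "lifts_over E p h (({t-d..t+d} \<inter> {0..1}) \<times> {0..1})"
      using strip by force
    have "lifts_over E p h ({a..b} \<times> {0..1})"
      if "a \<le> t" "t \<le> b" "b - a < d" "0 \<le> a" "b \<le> 1" for a b
      using that by (intro lifts_over_subset[OF d(2)]) auto
    then show "\<exists>d>0. \<forall>a b. a \<le> t \<and> t \<le> b \<and> b - a < d \<longrightarrow> 0 \<le> a \<and> a \<le> b \<and> b \<le> 1 \<longrightarrow>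
          lifts_over E p h ({a..b} \<times> {0..1})"
      using d(1) by blast
  qed simp
  then show ?thesis by simp
qed

text \<open>The loop \<open>p \<circ> \<gamma>\<close> contracts inside \<open>S\<close> with fixed base point. Lift the contraction, starting at
  \<open>\<gamma> 0\<close>: the lift of the bottom edge is \<open>\<gamma>\<close> itself, while on the other three edges the contraction is
  constant, hence so is its lift. Thus the two ends of the bottom edge have the same lift.\<close>

lemma proper_local_homeo_monodromy:
  assumes E: "Hausdorff_space E"
    and p: "continuous_map E B p" "proper_map E B p" "open_map E B p" "locally_injective E p"
    and S: "simply_connected_space (subtopology B S)"
    and \<gamma>: "pathin E \<gamma>" "p ` \<gamma> ` {0..1} \<subseteq> S" "p (\<gamma> 0) = p (\<gamma> 1)"
  shows "\<gamma> 0 = \<gamma> 1"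
proof -
  let ?Q = "{0..1::real} \<times> {0..1::real}"
  let ?q = "p \<circ> \<gamma>"
  have "pathin B ?q" using \<gamma>(1) p(1) by (rule pathin_compose)
  then have "pathin (subtopology B S) ?q"
    using \<gamma>(2) by (auto simp: pathin_def continuous_map_in_subtopology)
  moreover have "?q 0 = ?q 1" using \<gamma>(3) by simp
  ultimately have "homotopic_with (\<lambda>r. r 0 = ?q 0 \<and> r 1 = ?q 0) (top_of_set {0..1})
      (subtopology B S) ?q (\<lambda>t. ?q 0)"
    using S unfolding simply_connected_space_def by blast
  then have "\<exists>h. continuous_map (prod_topology (top_of_set {0..1::real}) (top_of_set {0..1::real})) (subtopology B S) h
      \<and> (\<forall>x. h (0,x) = ?q x) \<and> (\<forall>x. h (1,x) = ?q 0) \<and> (\<forall>t\<in>{0..1}. h (t,0) = ?q 0 \<and> h (t,1) = ?q 0)"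
    unfolding homotopic_with_def .
  then obtain h where h: "continuous_map (prod_topology (top_of_set {0..1::real}) (top_of_set {0..1::real})) (subtopology B S) h"
     "\<forall>x. h (0,x) = ?q x" "\<forall>x. h (1,x) = ?q 0" "\<forall>t\<in>{0..1}. h (t,0) = ?q 0 \<and> h (t,1) = ?q 0"
    by (elim exE conjE) (rule that)
  have Qtop: "prod_topology (top_of_set {0..1::real}) (top_of_set {0..1::real}) = top_of_set ?Q"
    by (simp add: subtopology_Times)
  have hB: "continuous_map (top_of_set ?Q) B h"
    using h(1) by (simp add: Qtop continuous_map_in_subtopology)
  have \<gamma>0: "\<gamma> 0 \<in> topspace E" using \<gamma>(1) by (auto simp: pathin_def continuous_map_def)
  then obtain s where s: "continuous_map (top_of_set ?Q) E s" "\<forall>z\<in>?Q. p (s z) = h z" "s (0,0) = \<gamma> 0"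
    using lifts_over_square[OF E p(2-4) hB, unfolded lifts_over_def, rule_format, of "(0,0)" "\<gamma> 0"] h(2) by auto
  have bottom: "s (0,1) = \<gamma> 1"
  proof (rule lift_unique[OF E p(4), of "top_of_set {0..1::real}" 0 1 "\<lambda>u. s (0,u)" \<gamma>])
    have c: "continuous_map (top_of_set {0..1::real}) (top_of_set ?Q) (\<lambda>u. (0,u))"
      by (auto simp: continuous_map_in_subtopology intro!: continuous_intros)
    show "continuous_map (top_of_set {0..1::real}) E (\<lambda>u. s (0,u))"
      using continuous_map_compose[OF c s(1)] by (simp add: comp_def)
  qed (use \<gamma> s h(2) in \<open>auto simp: pathin_def\<close>)
  \<comment> \<open>The three edges other than the one carrying \<open>\<gamma>\<close>.\<close>
  define L where "L = {0..1::real} \<times> {0} \<union> {1} \<times> {0..1::real} \<union> {0..1::real} \<times> {1::real}"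
  have "connected L"
  proof -
    have 1: "connected ({0..1::real} \<times> {0::real} \<union> {1} \<times> {0..1::real})"
    proof (rule connected_Un)
      have "(1,0) \<in> ({0..1::real} \<times> {0::real}) \<inter> ({1} \<times> {0..1::real})" by simp
      then show "({0..1::real} \<times> {0::real}) \<inter> ({1} \<times> {0..1::real}) \<noteq> {}" by blast
    qed (rule connected_Times; simp)+
    have "(1,1) \<in> ({0..1::real} \<times> {0::real} \<union> {1} \<times> {0..1::real}) \<inter> ({0..1::real} \<times> {1::real})" by simp
    then have "({0..1::real} \<times> {0::real} \<union> {1} \<times> {0..1::real}) \<inter> ({0..1::real} \<times> {1::real}) \<noteq> {}" by blast
    moreover have "connected ({0..1::real} \<times> {1::real})" by (rule connected_Times; simp)
    ultimately show ?thesis unfolding L_def by (intro connected_Un 1)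
  qed
  have "s (0,1) = \<gamma> 0"
  proof (rule lift_unique[OF E p(4), of "top_of_set L" "(0,0)" "(0,1)" s "\<lambda>z. \<gamma> 0"])
    show "continuous_map (top_of_set L) E s"
      by (rule continuous_map_from_subtopology_mono[OF s(1)]) (auto simp: L_def)
    show "p (s z) = p (\<gamma> 0)" if "z \<in> topspace (top_of_set L)" for z
    proof -
      have "z \<in> ?Q" "h z = p (\<gamma> 0)"
        using that h(3,4) by (auto simp: L_def)
      then show ?thesis using s(2) by metis
    qed
    show "connected_space (top_of_set L)"
      using \<open>connected L\<close> by (simp flip: connectedin_iff_connected add: connectedin_def)
  qed (use s(3) \<gamma>0 in \<open>auto simp: L_def\<close>)
  with bottom show ?thesis by simp
qed

section \<open>Invariance of domain for locally Euclidean spaces\<close>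

lemma openin_manifold_interior: "openin X (manifold_interior n X)"
proof (subst openin_subopen, intro ballI)
  fix x assume "x \<in> manifold_interior n X"
  then obtain U where U: "openin X U" "x \<in> U" "subtopology X U homeomorphic_space Euclidean_space n"
    by (auto simp: manifold_interior_def)
  moreover have "U \<subseteq> manifold_interior n X"
    using U openin_subset by (fastforce simp: manifold_interior_def)
  ultimately show "\<exists>T. openin X T \<and> x \<in> T \<and> T \<subseteq> manifold_interior n X" by blast
qed

lemma manifold_interior_subset: "manifold_interior n X \<subseteq> topspace X"
  by (auto simp: manifold_interior_def)

lemma manifold_interior_chart:
  assumes "x \<in> manifold_interior n X"
  obtains U \<phi> \<theta> where "openin X U" "x \<in> U"
    "homeomorphic_maps (subtopology X U) (Euclidean_space n) \<phi> \<theta>"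
  using assms by (auto simp: manifold_interior_def homeomorphic_space_def)

text \<open>Invariance of domain, transported from the model space through charts of \<open>A\<close>.\<close>

lemma openin_image_of_locally_Euclidean:
  assumes N: "openin A N" "N \<subseteq> manifold_interior m A"
    and h: "continuous_map (subtopology A N) (Euclidean_space m) h" "inj_on h N"
  shows "openin (Euclidean_space m) (h ` N)"
proof (subst openin_subopen, intro ballI)
  fix y assume "y \<in> h ` N"
  then obtain a where a: "a \<in> N" "y = h a" by blast
  obtain V \<psi> \<theta> where V: "openin A V" "a \<in> V"
      and hom: "homeomorphic_maps (subtopology A V) (Euclidean_space m) \<psi> \<theta>"
    using a N(2) by (meson manifold_interior_chart subsetD)
  have \<theta>: "continuous_map (Euclidean_space m) (subtopology A V) \<theta>"
    and \<psi>: "continuous_map (subtopology A V) (Euclidean_space m) \<psi>"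
    and inv: "\<forall>x \<in> topspace (subtopology A V). \<theta> (\<psi> x) = x" "\<forall>z \<in> topspace (Euclidean_space m). \<psi> (\<theta> z) = z"
    using hom unfolding homeomorphic_maps_def by auto
  have \<theta>A: "continuous_map (Euclidean_space m) A \<theta>"
    using \<theta> continuous_map_in_subtopology by blast
  define S where "S = {z \<in> topspace (Euclidean_space m). \<theta> z \<in> N}"
  have S: "openin (Euclidean_space m) S"
    unfolding S_def using \<theta>A N(1) by (rule openin_continuous_map_preimage)
  have "continuous_map (subtopology (Euclidean_space m) S) (subtopology A N) \<theta>"
    using \<theta>A by (auto simp: continuous_map_in_subtopology S_def continuous_map_from_subtopology)
  then have "continuous_map (subtopology (Euclidean_space m) S) (Euclidean_space m) (h \<circ> \<theta>)"
    using h(1) continuous_map_compose by blast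
  moreover have "inj_on (h \<circ> \<theta>) S"
    using h(2) inv(2) by (auto simp: inj_on_def S_def) metis
  ultimately have "openin (Euclidean_space m) ((h \<circ> \<theta>) ` S)"
    using invariance_of_domain_Euclidean_space S by blast
  moreover have "(h \<circ> \<theta>) ` S \<subseteq> h ` N" by (auto simp: S_def)
  moreover have "a \<in> topspace (subtopology A V)"
    using V N(1) a openin_subset by auto
  then have "\<psi> a \<in> S" "\<theta> (\<psi> a) = a"
    using inv(1) continuous_map_image_subset_topspace[OF \<psi>] a(1) by (auto simp: S_def)
  then have "y \<in> (h \<circ> \<theta>) ` S" using a(2) by (metis comp_apply imageI)
  ultimately show "\<exists>T. openin (Euclidean_space m) T \<and> y \<in> T \<and> T \<subseteq> h ` N" by blast
qed

lemma topspace_half_space: "topspace (half_space n) = {x. (\<forall>i\<ge>n. x i = 0) \<and> 0 \<le> x 0}"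
  by (auto simp: half_space_def topspace_Euclidean_space)

lemma continuous_map_half_space_iff:
  "continuous_map X (half_space n) h \<longleftrightarrow>
     continuous_map X (Euclidean_space n) h \<and> (\<forall>x\<in>topspace X. 0 \<le> h x 0)"
  by (auto simp: half_space_def continuous_map_in_subtopology)

lemma continuous_map_Euclidean_space_coordinatewise:
  "continuous_map X (Euclidean_space n) h \<longleftrightarrow>
     (\<forall>i. continuous_map X euclideanreal (\<lambda>x. h x i)) \<and> (\<forall>x\<in>topspace X. \<forall>i\<ge>n. h x i = 0)"
  by (auto simp: Euclidean_space_def continuous_map_in_subtopology continuous_map_componentwise_UNIV)

lemma continuous_map_Euclidean_space_coordinate:
  "continuous_map (Euclidean_space n) euclideanreal (\<lambda>x. x i)"
proof -
  have "continuous_map (Euclidean_space n) (Euclidean_space n) (\<lambda>x. x)" by simp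
  then show ?thesis unfolding continuous_map_Euclidean_space_coordinatewise by blast
qed

text \<open>The image is open in the full Euclidean space by invariance of domain. Were it to contain a point of
  the bounding hyperplane, it would also contain points slightly below it. This one fact yields both
  the chart description of the boundary and the preservation of interiors by immersions.\<close>

lemma half_space_image_of_locally_Euclidean:
  assumes N: "openin A N" "N \<subseteq> manifold_interior m A" and m: "m > 0"
    and h: "continuous_map (subtopology A N) (half_space m) h" "inj_on h N"
    and a: "a \<in> N"
  shows "0 < h a 0"
proof (rule ccontr)
  have hE: "continuous_map (subtopology A N) (Euclidean_space m) h"
    using h(1) by (simp add: continuous_map_half_space_iff)
  have NA: "N \<subseteq> topspace A" using N(1) openin_subset by blast
  have nonneg: "0 \<le> h x 0" if "x \<in> N" for x
    using h(1) that NA by (auto simp: continuous_map_half_space_iff)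
  assume "\<not> 0 < h a 0"
  then have 0: "h a 0 = 0" using nonneg[OF a] by simp
  have op: "openin (Euclidean_space m) (h ` N)"
    using openin_image_of_locally_Euclidean N hE h(2) by blast
  let ?l = "\<lambda>t::real. (h a)(0 := t)"
  have "h a \<in> topspace (Euclidean_space m)" using op openin_subset a by blast
  then have "continuous_map euclideanreal (Euclidean_space m) ?l"
    using m by (auto simp: continuous_map_Euclidean_space_coordinatewise topspace_Euclidean_space)
  then have "open {t. ?l t \<in> h ` N}"
    using openin_continuous_map_preimage[OF _ op] by fastforce
  moreover have "0 \<in> {t. ?l t \<in> h ` N}"
    using a 0 by (auto simp: fun_upd_idem)
  ultimately obtain d where d: "d > 0" "ball 0 d \<subseteq> {t. ?l t \<in> h ` N}"
    using openE by blast
  then have "- (d/2) \<in> {t. ?l t \<in> h ` N}" by (intro subsetD[OF d(2)]) auto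
  then obtain x where "x \<in> N" "?l (- (d/2)) = h x" by auto
  then show False using nonneg[of x] d(1) by (metis divide_pos_pos fun_upd_same neg_0_le_iff_le not_less zero_less_numeral)
qed

text \<open>This serves twice: for the interiors in dimension \<open>n\<close>, and for the boundaries, which are locally
  Euclidean of dimension \<open>n - 1\<close>.\<close>

lemma locally_Euclidean_locally_injective_imp_open_map:
  assumes A: "manifold_interior m A = topspace A" and B: "manifold_interior m B = topspace B"
    and g: "continuous_map A B g" "locally_injective A g"
  shows "open_map A B g"
  unfolding open_map_def
proof (intro allI impI)
  fix U assume U: "openin A U"
  show "openin B (g ` U)"
  proof (subst openin_subopen, intro ballI)
    fix y assume "y \<in> g ` U"
    then obtain a where a: "a \<in> U" "y = g a" by blast
    have aA: "a \<in> topspace A" using a U openin_subset by blast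
    then obtain M where M: "openin A M" "a \<in> M" "inj_on g M"
      using g(2) by (auto simp: locally_injective_def)
    have "y \<in> manifold_interior m B"
      using B a(2) aA continuous_map_image_subset_topspace[OF g(1)] by auto
    then obtain V \<phi> \<theta> where V: "openin B V" "y \<in> V"
        and hom: "homeomorphic_maps (subtopology B V) (Euclidean_space m) \<phi> \<theta>"
      by (rule manifold_interior_chart)
    have \<phi>: "continuous_map (subtopology B V) (Euclidean_space m) \<phi>"
      and inv: "\<forall>x \<in> topspace (subtopology B V). \<theta> (\<phi> x) = x"
      using hom unfolding homeomorphic_maps_def by auto
    define N where "N = U \<inter> M \<inter> {x \<in> topspace A. g x \<in> V}"
    have N: "openin A N"
      unfolding N_def using U M V openin_continuous_map_preimage[OF g(1)] by blast
    have VB: "V \<subseteq> topspace B" using V(1) openin_subset by blast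
    have gV: "g x \<in> V" if "x \<in> N" for x using that by (simp add: N_def)
    have "continuous_map (subtopology A N) (subtopology B V) g"
      using g(1) gV by (auto simp: continuous_map_in_subtopology continuous_map_from_subtopology)
    then have c: "continuous_map (subtopology A N) (Euclidean_space m) (\<phi> \<circ> g)"
      using \<phi> continuous_map_compose by blast
    have i: "inj_on (\<phi> \<circ> g) N"
    proof (rule inj_onI)
      fix x x' assume x: "x \<in> N" "x' \<in> N" "(\<phi> \<circ> g) x = (\<phi> \<circ> g) x'"
      then have "\<theta> (\<phi> (g x)) = \<theta> (\<phi> (g x'))" by simp
      moreover have "\<theta> (\<phi> (g x)) = g x" "\<theta> (\<phi> (g x')) = g x'"
        using inv gV[OF x(1)] gV[OF x(2)] VB by auto
      ultimately have "g x = g x'" by simp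
      then show "x = x'" using M(3) x by (auto simp: N_def inj_on_def)
    qed
    have "N \<subseteq> manifold_interior m A" using N A openin_subset by blast
    then have "openin (Euclidean_space m) ((\<phi> \<circ> g) ` N)"
      using openin_image_of_locally_Euclidean N c i by blast
    then have "openin (subtopology B V) {y \<in> topspace (subtopology B V). \<phi> y \<in> (\<phi> \<circ> g) ` N}"
      by (rule openin_continuous_map_preimage[OF \<phi>])
    moreover have "{y \<in> topspace (subtopology B V). \<phi> y \<in> (\<phi> \<circ> g) ` N} = g ` N" (is "?L = _")
    proof
      show "?L \<subseteq> g ` N"
      proof
        fix y assume "y \<in> ?L"
        then obtain x where x: "x \<in> N" "\<phi> y = \<phi> (g x)" "y \<in> V" by auto
        then have "\<theta> (\<phi> y) = \<theta> (\<phi> (g x))" by simp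
        moreover have "\<theta> (\<phi> y) = y" "\<theta> (\<phi> (g x)) = g x"
          using inv x(3) gV[OF x(1)] VB by auto
        ultimately have "y = g x" by simp
        then show "y \<in> g ` N" using x(1) by blast
      qed
      show "g ` N \<subseteq> ?L" using gV VB by auto
    qed
    ultimately have "openin B (g ` N)"
      using V(1) by (simp add: openin_open_subtopology)
    moreover have "y \<in> g ` N" using a M V aA by (auto simp: N_def)
    moreover have "g ` N \<subseteq> g ` U" by (auto simp: N_def)
    ultimately show "\<exists>T. openin B T \<and> y \<in> T \<and> T \<subseteq> g ` U" by blast
  qed
qed

section \<open>The boundary of a manifold\<close>

text \<open>The logarithm in the distinguished coordinate.\<close>

lemma open_half_space_homeomorphic_Euclidean_space:
  assumes "m > 0"
  shows "subtopology (Euclidean_space m) {x. 0 < x 0} homeomorphic_space Euclidean_space m"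
  unfolding homeomorphic_space_def
proof (intro exI)
  let ?f = "\<lambda>x::nat\<Rightarrow>real. x(0 := ln (x 0))" and ?g = "\<lambda>x::nat\<Rightarrow>real. x(0 := exp (x 0))"
  note id = continuous_map_Euclidean_space_coordinate[of m]
  have "continuous_map (subtopology (Euclidean_space m) {x. 0 < x 0}) (top_of_set {0<..}) (\<lambda>x. x 0)"
    using id[of 0] by (auto simp: continuous_map_in_subtopology continuous_map_from_subtopology)
  moreover have "continuous_map (top_of_set {0<..}) euclideanreal (ln :: real \<Rightarrow> real)"
    by (auto intro!: continuous_intros)
  ultimately have "continuous_map (subtopology (Euclidean_space m) {x. 0 < x 0}) euclideanreal (ln \<circ> (\<lambda>x. x 0))"
    by (rule continuous_map_compose)
  then have ln: "continuous_map (subtopology (Euclidean_space m) {x. 0 < x 0}) euclideanreal (\<lambda>x. ln (x 0))"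
    by (simp add: comp_def)
  have "continuous_map euclideanreal euclideanreal (exp :: real \<Rightarrow> real)"
    by (auto intro!: continuous_intros)
  with id[of 0] have "continuous_map (Euclidean_space m) euclideanreal (exp \<circ> (\<lambda>x. x 0))"
    by (rule continuous_map_compose)
  then have exp: "continuous_map (Euclidean_space m) euclideanreal (\<lambda>x. exp (x 0))"
    by (simp add: comp_def)
  have "continuous_map (subtopology (Euclidean_space m) {x. 0 < x 0}) euclideanreal (\<lambda>x. ?f x i)" for i
    using ln id[of i] by (cases "i = 0") (auto simp: continuous_map_from_subtopology)
  moreover have "continuous_map (Euclidean_space m) euclideanreal (\<lambda>x. ?g x i)" for i
    using exp id[of i] by (cases "i = 0") auto
  ultimately show "homeomorphic_maps (subtopology (Euclidean_space m) {x. 0 < x 0}) (Euclidean_space m) ?f ?g"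
    using assms
    by (auto simp: homeomorphic_maps_def continuous_map_in_subtopology 
       continuous_map_Euclidean_space_coordinatewise topspace_Euclidean_space)
qed

text \<open>The topological invariance of the boundary: a point on the bounding hyperplane in one chart cannot have a
  Euclidean neighbourhood, since the chart would embed that neighbourhood as an open set of Euclidean space.\<close>

lemma half_space_chart_interior_iff:
  assumes m: "m > 0" and U: "openin Z U" "z \<in> U"
    and hom: "homeomorphic_maps (subtopology Z U) (half_space m) \<phi> \<theta>"
  shows "z \<in> manifold_interior m Z \<longleftrightarrow> 0 < \<phi> z 0"
proof
  have UZ: "U \<subseteq> topspace Z" using U openin_subset by blast
  have \<phi>: "continuous_map (subtopology Z U) (half_space m) \<phi>"
    and \<theta>: "continuous_map (half_space m) (subtopology Z U) \<theta>"
    and inv: "\<forall>x \<in> topspace (subtopology Z U). \<theta> (\<phi> x) = x"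
    using hom unfolding homeomorphic_maps_def by auto
  show "0 < \<phi> z 0" if "z \<in> manifold_interior m Z"
  proof (rule half_space_image_of_locally_Euclidean[of Z "U \<inter> manifold_interior m Z" m])
    show "continuous_map (subtopology Z (U \<inter> manifold_interior m Z)) (half_space m) \<phi>"
      using \<phi> by (rule continuous_map_from_subtopology_mono) auto
    show "inj_on \<phi> (U \<inter> manifold_interior m Z)"
      using inv UZ by (intro inj_on_inverseI[where g = \<theta>]) auto
  qed (use U m that openin_manifold_interior in auto)
  assume pos: "0 < \<phi> z 0"
  define V where "V = {w \<in> U. 0 < \<phi> w 0}"
  let ?H = "{x::nat\<Rightarrow>real. 0 < x 0}"
  have "homeomorphic_maps (subtopology (subtopology Z U) {w. 0 < \<phi> w 0})
      (subtopology (half_space m) ?H) \<phi> \<theta>"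
    using hom
  proof (rule homeomorphic_maps_subtopologies)
    have surj: "\<phi> ` topspace (subtopology Z U) = topspace (half_space m)"
      using hom homeomorphic_imp_surjective_map homeomorphic_maps_map by blast
    show "\<phi> ` (topspace (subtopology Z U) \<inter> {w. 0 < \<phi> w 0}) = topspace (half_space m) \<inter> ?H"
      unfolding surj[symmetric] by auto
  qed
  moreover have "subtopology (subtopology Z U) {w. 0 < \<phi> w 0} = subtopology Z V"
    by (simp add: subtopology_subtopology V_def Int_def)
  moreover have "{x. 0 \<le> x 0} \<inter> ?H = ?H" by auto
  then have "subtopology (half_space m) ?H = subtopology (Euclidean_space m) ?H"
    by (simp add: half_space_def subtopology_subtopology)
  ultimately have "subtopology Z V homeomorphic_space Euclidean_space m"
    using open_half_space_homeomorphic_Euclidean_space[OF m]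
    by (metis homeomorphic_maps_imp_homeomorphic_space homeomorphic_space_trans)
  moreover have "openin Z V"
  proof -
    have "continuous_map (subtopology Z U) euclideanreal (\<lambda>w. \<phi> w 0)"
      using \<phi> by (simp add: continuous_map_half_space_iff continuous_map_Euclidean_space_coordinatewise)
    then have "openin (subtopology Z U) {w \<in> topspace (subtopology Z U). \<phi> w 0 \<in> {0<..}}"
      by (rule openin_continuous_map_preimage) auto
    moreover have "{w \<in> topspace (subtopology Z U). \<phi> w 0 \<in> {0<..}} = V"
      using UZ by (auto simp: V_def)
    ultimately show ?thesis using U(1) by (simp add: openin_open_subtopology)
  qed
  ultimately show "z \<in> manifold_interior m Z"
    using U(2) UZ pos by (auto simp: manifold_interior_def V_def)
qed

text \<open>In dimension \<open>0\<close> the two models coincide, so that a point of the boundary forces \<open>n > 0\<close>.\<close>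

lemma half_space_0: "half_space 0 = Euclidean_space 0"
proof -
  have "{x::nat\<Rightarrow>real. 0 \<le> x 0} \<inter> topspace (Euclidean_space 0) = topspace (Euclidean_space 0)"
    by (auto simp: topspace_Euclidean_space)
  then show ?thesis
    unfolding half_space_def by (metis subtopology_restrict subtopology_topspace inf_commute)
qed

lemma manifold_boundary_chart:
  assumes Z: "topological_manifold n Z" and z: "z \<in> manifold_boundary n Z"
  obtains U \<phi> \<theta> where "n > 0" "openin Z U" "z \<in> U"
    "homeomorphic_maps (subtopology Z U) (half_space n) \<phi> \<theta>"
    "\<And>w. w \<in> U \<Longrightarrow> w \<in> manifold_boundary n Z \<longleftrightarrow> \<phi> w 0 = 0"
proof -
  obtain \<U> where \<U>: "\<Union>\<U> = topspace Z" "\<forall>U\<in>\<U>. openin Z U \<and>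
           (subtopology Z U homeomorphic_space Euclidean_space n \<or>
            subtopology Z U homeomorphic_space half_space n)"
    using Z by (auto simp: topological_manifold_def)
  have zZ: "z \<in> topspace Z" "z \<notin> manifold_interior n Z"
    using z by (auto simp: manifold_boundary_def)
  then obtain U where U: "U \<in> \<U>" "z \<in> U" using \<U>(1) by blast
  then have U': "openin Z U" using \<U>(2) by blast
  have "\<not> subtopology Z U homeomorphic_space Euclidean_space n"
    using zZ U(2) U' by (auto simp: manifold_interior_def)
  then have hs: "subtopology Z U homeomorphic_space half_space n" "n \<noteq> 0"
    using \<U>(2) U(1) half_space_0 by metis+
  then obtain \<phi> \<theta> where hom: "homeomorphic_maps (subtopology Z U) (half_space n) \<phi> \<theta>"
    by (auto simp: homeomorphic_space_def)
  have UZ: "U \<subseteq> topspace Z" using U' openin_subset by blast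
  have "w \<in> manifold_boundary n Z \<longleftrightarrow> \<phi> w 0 = 0" if w: "w \<in> U" for w
  proof -
    have "continuous_map (subtopology Z U) (half_space n) \<phi>"
      using hom unfolding homeomorphic_maps_def by auto
    then have "0 \<le> \<phi> w 0" using w UZ by (auto simp: continuous_map_half_space_iff)
    then show ?thesis
      using half_space_chart_interior_iff[OF _ U' w hom] hs(2) w UZ
      by (auto simp: manifold_boundary_def)
  qed
  then show thesis using that hs(2) U' U(2) hom by blast
qed

text \<open>A half-space chart maps the boundary points of its domain onto the bounding hyperplane, which an index
  shift identifies with Euclidean space of one dimension less.\<close>

lemma manifold_interior_boundary:
  assumes Z: "topological_manifold n Z"
  shows "manifold_interior (n - 1) (subtopology Z (manifold_boundary n Z)) =
    topspace (subtopology Z (manifold_boundary n Z))" (is "manifold_interior _ ?D = _")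
proof
  show "topspace ?D \<subseteq> manifold_interior (n - 1) ?D"
  proof
    fix z assume "z \<in> topspace ?D"
    then have z: "z \<in> manifold_boundary n Z" by simp
    obtain U \<phi> \<theta> where n: "n > 0" and U: "openin Z U" "z \<in> U"
      and hom: "homeomorphic_maps (subtopology Z U) (half_space n) \<phi> \<theta>"
      and bd: "\<And>w. w \<in> U \<Longrightarrow> w \<in> manifold_boundary n Z \<longleftrightarrow> \<phi> w 0 = 0"
      using manifold_boundary_chart[OF Z z] by metis
    let ?P = "{x::nat\<Rightarrow>real. x 0 = 0}"
    have "homeomorphic_maps (subtopology (subtopology Z U) (manifold_boundary n Z))
        (subtopology (half_space n) ?P) \<phi> \<theta>"
      using hom
    proof (rule homeomorphic_maps_subtopologies)
      have surj: "\<phi> ` topspace (subtopology Z U) = topspace (half_space n)"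
        using hom homeomorphic_imp_surjective_map homeomorphic_maps_map by blast
      show "\<phi> ` (topspace (subtopology Z U) \<inter> manifold_boundary n Z) = topspace (half_space n) \<inter> ?P"
        unfolding surj[symmetric] using bd by auto
    qed
    then have 1: "subtopology (subtopology Z U) (manifold_boundary n Z) homeomorphic_space subtopology (half_space n) ?P"
      by (rule homeomorphic_maps_imp_homeomorphic_space)
    let ?f = "\<lambda>x::nat\<Rightarrow>real. \<lambda>i. x (Suc i)" and ?g = "\<lambda>x::nat\<Rightarrow>real. \<lambda>i. case i of 0 \<Rightarrow> 0 | Suc j \<Rightarrow> x j"
    have f: "continuous_map (subtopology (half_space n) ?P) (Euclidean_space (n - 1)) ?f"
      using continuous_map_Euclidean_space_coordinate by (auto simp: continuous_map_Euclidean_space_coordinatewise half_space_def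
         continuous_map_from_subtopology topspace_Euclidean_space)
    have "continuous_map (Euclidean_space (n-1)) euclideanreal (\<lambda>x. ?g x i)" for i
      using continuous_map_Euclidean_space_coordinate by (cases i) auto
    then have g: "continuous_map (Euclidean_space (n - 1)) (subtopology (half_space n) ?P) ?g"
      using n by (auto simp: continuous_map_in_subtopology continuous_map_half_space_iff
        continuous_map_Euclidean_space_coordinatewise topspace_Euclidean_space split: nat.split)
    have "homeomorphic_maps (subtopology (half_space n) ?P) (Euclidean_space (n - 1)) ?f ?g"
      unfolding homeomorphic_maps_def using f g
      by (auto simp: topspace_half_space fun_eq_iff split: nat.split)
    then have "subtopology (subtopology Z U) (manifold_boundary n Z) homeomorphic_space Euclidean_space (n - 1)"
      using 1 by (meson homeomorphic_maps_imp_homeomorphic_space homeomorphic_space_trans)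
    moreover have "subtopology (subtopology Z U) (manifold_boundary n Z) = subtopology ?D (manifold_boundary n Z \<inter> U)"
      by (simp add: subtopology_subtopology Int_ac)
    moreover have "openin ?D (manifold_boundary n Z \<inter> U)"
      using U(1) by (rule openin_subtopology_Int2)
    ultimately show "z \<in> manifold_interior (n - 1) ?D"
      using z U(2) openin_subset[OF U(1)] by (auto simp: manifold_interior_def)
  qed
qed (rule manifold_interior_subset)

lemma manifold_interior_interior:
  "manifold_interior n (subtopology Z (manifold_interior n Z)) = topspace (subtopology Z (manifold_interior n Z))"
    (is "manifold_interior _ ?I = _")
proof
  show "topspace ?I \<subseteq> manifold_interior n ?I"
  proof
    fix z assume "z \<in> topspace ?I"
    then have z: "z \<in> manifold_interior n Z" "z \<in> topspace Z" by auto
    then obtain U where U: "openin Z U" "z \<in> U" "subtopology Z U homeomorphic_space Euclidean_space n"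
      by (auto simp: manifold_interior_def)
    have "U \<subseteq> manifold_interior n Z"
      using U openin_subset by (fastforce simp: manifold_interior_def)
    then have "subtopology ?I U = subtopology Z U" "openin ?I U"
      using U(1) by (auto simp: subtopology_subtopology Int_absorb1 openin_open_subtopology openin_manifold_interior)
    then show "z \<in> manifold_interior n ?I"
      using z U by (auto simp: manifold_interior_def[of _ ?I])
  qed
qed (rule manifold_interior_subset)

lemma locally_path_connected_space_if_locally_Euclidean:
  assumes "manifold_interior m A = topspace A"
  shows "locally_path_connected_space A"
  unfolding locally_path_connected_space
proof (intro allI impI, elim conjE)
  fix V x assume V: "openin A V" "x \<in> V"
  then have "x \<in> manifold_interior m A" using assms openin_subset by blast
  then obtain U where U: "openin A U" "x \<in> U" "subtopology A U homeomorphic_space Euclidean_space m"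
    by (auto simp: manifold_interior_def)
  then have "locally_path_connected_space (subtopology A U)"
    using homeomorphic_locally_path_connected_space locally_path_connected_Euclidean_space by blast
  moreover have "openin (subtopology A U) (U \<inter> V)" using V(1) by (rule openin_subtopology_Int2)
  ultimately obtain W where W: "openin (subtopology A U) W" "path_connectedin (subtopology A U) W" "x \<in> W" "W \<subseteq> U \<inter> V"
    unfolding locally_path_connected_space using U(2) V(2) by (metis IntI)
  then show "\<exists>W. openin A W \<and> path_connectedin A W \<and> x \<in> W \<and> W \<subseteq> V"
    using U(1) by (metis Int_subset_iff openin_open_subtopology path_connectedin_subtopology)
qed

section \<open>Simply connected neighbourhoods of boundary points\<close>

lemma simply_connected_space_homeomorphic_maps:
  assumes hom: "homeomorphic_maps A B f g" and A: "simply_connected_space A"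
  shows "simply_connected_space B"
  unfolding simply_connected_space_def
proof (intro conjI allI impI)
  show "path_connected_space B"
    using hom A homeomorphic_maps_imp_homeomorphic_space homeomorphic_path_connected_space
    unfolding simply_connected_space_def by blast
  have f: "continuous_map A B f" and g: "continuous_map B A g" and fg: "\<forall>y\<in>topspace B. f (g y) = y"
    using hom unfolding homeomorphic_maps_def by auto
  fix p assume p: "pathin B p \<and> p 0 = p 1"
  have pB: "p t \<in> topspace B" if "t \<in> {0..1}" for t
    using p that unfolding pathin_def by (auto simp: continuous_map_def Pi_iff)
  have "pathin A (g \<circ> p)" "(g \<circ> p) 0 = (g \<circ> p) 1"
    using p g pathin_compose by (blast, simp)
  then have "homotopic_with (\<lambda>q. q 0 = (g \<circ> p) 0 \<and> q 1 = (g \<circ> p) 0) (top_of_set {0..1}) A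
      (g \<circ> p) (\<lambda>t. (g \<circ> p) 0)"
    using A unfolding simply_connected_space_def by blast
  then have 1: "homotopic_with (\<lambda>q. q 0 = p 0 \<and> q 1 = p 0) (top_of_set {0..1}) B
      (f \<circ> (g \<circ> p)) (f \<circ> (\<lambda>t. (g \<circ> p) 0))"
    by (rule homotopic_with_compose_continuous_map_left[OF _ f]) (use pB[of 0] fg in auto)
  have 2: "homotopic_with (\<lambda>q. q 0 = p 0 \<and> q 1 = p 0) (top_of_set {0..1}) B p (f \<circ> (g \<circ> p))"
    using p pB fg by (intro homotopic_with_equal) (auto simp: pathin_def)
  have 3: "f \<circ> (\<lambda>t. (g \<circ> p) 0) = (\<lambda>t. p 0)"
    using pB[of 0] fg by auto
  show "homotopic_with (\<lambda>q. q 0 = p 0 \<and> q 1 = p 0) (top_of_set {0..1}) B p (\<lambda>t. p 0)"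
    using homotopic_with_trans[OF 2 1] unfolding 3 .
qed

text \<open>Straight-line paths and homotopies, written coordinatewise: continuity into the product topology is
  then continuity of real functions.\<close>

lemma simply_connected_space_convex_Euclidean:
  assumes S: "S \<subseteq> topspace (Euclidean_space m)"
    and conv: "\<And>x y t. x \<in> S \<Longrightarrow> y \<in> S \<Longrightarrow> t \<in> {0..1} \<Longrightarrow> (\<lambda>i. (1 - t) * x i + t * y i) \<in> S"
  shows "simply_connected_space (subtopology (Euclidean_space m) S)"
  unfolding simply_connected_space_def path_connected_space_def
proof (intro conjI ballI allI impI)
  let ?E = "subtopology (Euclidean_space m) S"
  have cont: "continuous_map X ?E h \<longleftrightarrow> (\<forall>i. continuous_map X euclideanreal (\<lambda>x. h x i)) \<and> (\<forall>x\<in>topspace X. h x \<in> S)"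
    for X :: "'z topology" and h
    using S by (auto simp: continuous_map_in_subtopology continuous_map_Euclidean_space_coordinatewise
       topspace_Euclidean_space subset_iff)
  fix x y assume xy: "x \<in> topspace ?E" "y \<in> topspace ?E"
  have "pathin ?E (\<lambda>t i. (1 - t) * x i + t * y i)"
    unfolding pathin_def cont using xy conv by (auto intro!: continuous_intros)
  then show "\<exists>g. pathin ?E g \<and> g 0 = x \<and> g 1 = y"
    by (intro exI[of _ "\<lambda>t i. (1 - t) * x i + t * y i"]) auto
next
  let ?E = "subtopology (Euclidean_space m) S"
  have cont: "continuous_map X ?E h \<longleftrightarrow> (\<forall>i. continuous_map X euclideanreal (\<lambda>x. h x i)) \<and> (\<forall>x\<in>topspace X. h x \<in> S)"
    for X :: "'z topology" and h
    using S by (auto simp: continuous_map_in_subtopology continuous_map_Euclidean_space_coordinatewise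
       topspace_Euclidean_space subset_iff)
  fix p assume p: "pathin ?E p \<and> p 0 = p 1"
  then have pc: "continuous_on {0..1} (\<lambda>u. p u i)" and pS: "u \<in> {0..1} \<Longrightarrow> p u \<in> S" for i u
    unfolding pathin_def cont by auto
  let ?h = "\<lambda>z::real \<times> real. \<lambda>i. (1 - fst z) * p (snd z) i + fst z * p 0 i"
  have "continuous_on ({0..1} \<times> {0..1}) (\<lambda>z::real \<times> real. p (snd z) i)" for i
    by (rule continuous_on_compose2[OF pc]) (auto intro!: continuous_intros)
  then have "continuous_map (top_of_set ({0..1} \<times> {0..1})) ?E ?h"
    unfolding cont using conv pS by (auto intro!: continuous_intros)
  then have "continuous_map (prod_topology (top_of_set {0..1}) (top_of_set {0..1})) ?E ?h"
    by (simp add: subtopology_Times)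
  then show "homotopic_with (\<lambda>q. q 0 = p 0 \<and> q 1 = p 0) (top_of_set {0..1}) ?E p (\<lambda>t. p 0)"
    unfolding homotopic_with_def using p
    by (intro exI[of _ ?h]) (auto simp: algebra_simps fun_eq_iff)
qed

text \<open>In a half-space chart take a box around the image of \<open>z\<close>, cut down to the half-space. Its
  part in the interior is again convex and is nonempty. All local arguments at the boundary rest on this.\<close>

lemma manifold_boundary_simply_connected_nbhd:
  assumes Z: "topological_manifold n Z" and z: "z \<in> manifold_boundary n Z"
    and V: "openin Z V" "z \<in> V"
  obtains W where "openin Z W" "z \<in> W" "W \<subseteq> V" "W \<inter> manifold_interior n Z \<noteq> {}"
    "simply_connected_space (subtopology Z (W \<inter> manifold_interior n Z))"
proof -
  obtain U \<phi> \<theta> where n: "n > 0" and U: "openin Z U" "z \<in> U"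
    and hom: "homeomorphic_maps (subtopology Z U) (half_space n) \<phi> \<theta>"
    and bd: "\<And>w. w \<in> U \<Longrightarrow> w \<in> manifold_boundary n Z \<longleftrightarrow> \<phi> w 0 = 0"
    using manifold_boundary_chart[OF Z z] by metis
  have UZ: "U \<subseteq> topspace Z" using U openin_subset by blast
  have \<phi>: "continuous_map (subtopology Z U) (half_space n) \<phi>"
    and \<theta>: "continuous_map (half_space n) (subtopology Z U) \<theta>"
    and inv: "\<And>x. x \<in> U \<Longrightarrow> \<theta> (\<phi> x) = x" "\<And>x. x \<in> topspace (half_space n) \<Longrightarrow> \<phi> (\<theta> x) = x"
    using hom UZ unfolding homeomorphic_maps_def by auto
  have \<phi>U: "\<phi> w \<in> topspace (half_space n)" if "w \<in> U" for w
    using continuous_map_image_subset_topspace[OF \<phi>] that UZ by auto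
  have \<theta>U: "\<theta> x \<in> U" if "x \<in> topspace (half_space n)" for x
    using continuous_map_image_subset_topspace[OF \<theta>] that by auto
  have int: "w \<in> manifold_interior n Z \<longleftrightarrow> 0 < \<phi> w 0" if "w \<in> U" for w
    using bd[OF that] \<phi>U[OF that] that UZ by (auto simp: manifold_boundary_def topspace_half_space)
  define c where "c = \<phi> z"
  have c: "c \<in> topspace (half_space n)" "c 0 = 0"
    using \<phi>U U(2) bd z by (auto simp: c_def)
  let ?R = "product_topology (\<lambda>i::nat. euclideanreal) UNIV"
  have "half_space n = subtopology ?R ({x. \<forall>i\<ge>n. x i = 0} \<inter> {x. 0 \<le> x 0})"
    by (simp add: half_space_def Euclidean_space_def subtopology_subtopology)
  moreover have "{x. \<forall>i\<ge>n. x i = 0} \<inter> {x. 0 \<le> x 0} = topspace (half_space n)"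
    by (auto simp: topspace_half_space)
  ultimately have hs: "openin (half_space n) S \<longleftrightarrow> (\<exists>T. openin ?R T \<and> S = T \<inter> topspace (half_space n))" for S
    using openin_subtopology[of ?R "topspace (half_space n)" S] by argo
  have "continuous_map (half_space n) Z \<theta>" using \<theta> continuous_map_in_subtopology by blast
  then have "openin (half_space n) {x \<in> topspace (half_space n). \<theta> x \<in> V}"
    using V(1) by (rule openin_continuous_map_preimage)
  then obtain T where T: "openin ?R T" "{x \<in> topspace (half_space n). \<theta> x \<in> V} = T \<inter> topspace (half_space n)"
    using hs by blast
  have "\<theta> c = z" using inv(1)[OF U(2)] by (simp add: c_def)
  then have "c \<in> T \<inter> topspace (half_space n)" using c(1) V(2) by (simp flip: T(2))
  then have "c \<in> T" by simp
  then obtain J where J: "finite {i \<in> UNIV. J i \<noteq> topspace euclideanreal}" "\<forall>i\<in>UNIV. openin euclideanreal (J i)"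
      "c \<in> Pi\<^sub>E UNIV J" "Pi\<^sub>E UNIV J \<subseteq> T"
    using bspec[OF T(1)[unfolded openin_product_topology_alt] \<open>c \<in> T\<close>] by (elim exE conjE) (rule that)
  have "\<exists>e>0. ball (c i) e \<subseteq> J i" for i
    using J(2,3) by (simp add: PiE_iff open_contains_ball)
  then obtain e where e: "\<And>i. e i > 0" "\<And>i. ball (c i) (e i) \<subseteq> J i" by metis
  \<comment> \<open>A basic open set of the product topology inside \<open>T\<close> whose factors are convex; only finitely many
    of them are proper subsets.\<close>
  define K where "K i = (if J i = UNIV then UNIV else ball (c i) (e i))" for i
  have K: "open (K i)" "convex (K i)" "c i \<in> K i" "K i \<subseteq> J i" for i
    using e by (auto simp: K_def)
  have "Pi\<^sub>E UNIV K \<subseteq> Pi\<^sub>E UNIV J" by (rule PiE_mono) (rule K(4))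
  then have KT: "Pi\<^sub>E UNIV K \<subseteq> T" using J(4) by (rule order_trans)
  have "openin ?R (Pi\<^sub>E UNIV K)"
  proof -
    have "{i \<in> UNIV. K i \<noteq> topspace euclideanreal} \<subseteq> {i \<in> UNIV. J i \<noteq> topspace euclideanreal}"
      by (auto simp: K_def)
    then have "finite {i \<in> UNIV. K i \<noteq> topspace euclideanreal}" using J(1) finite_subset by blast
    then show ?thesis using K(1) unfolding openin_product_topology_alt by (intro ballI exI[of _ K]) simp
  qed
  define W' where "W' = Pi\<^sub>E UNIV K \<inter> topspace (half_space n)"
  define P where "P = {x \<in> W'. 0 < x 0}"
  have "openin (half_space n) W'"
    using \<open>openin ?R (Pi\<^sub>E UNIV K)\<close> hs unfolding W'_def by blast
  then have "openin (subtopology Z U) {w \<in> topspace (subtopology Z U). \<phi> w \<in> W'}"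
    by (rule openin_continuous_map_preimage[OF \<phi>])
  moreover define W where "W = {w \<in> U. \<phi> w \<in> W'}"
  moreover have "{w \<in> topspace (subtopology Z U). \<phi> w \<in> W'} = W" using UZ by (auto simp: W_def)
  ultimately have W: "openin Z W" using U(1) by (simp add: openin_open_subtopology)
  have zW: "z \<in> W" using U(2) c K(3) by (auto simp: W_def W'_def c_def[symmetric] PiE_iff)
  have WV: "W \<subseteq> V"
  proof
    fix w assume "w \<in> W"
    then have "w \<in> U" "\<phi> w \<in> T \<inter> topspace (half_space n)" using KT by (auto simp: W_def W'_def)
    then have "\<theta> (\<phi> w) \<in> V" using T(2) by blast
    then show "w \<in> V" using inv(1) \<open>w \<in> U\<close> by simp
  qed
  have Wint: "W \<inter> manifold_interior n Z = {w \<in> U. \<phi> w \<in> P}"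
    using int by (auto simp: W_def P_def)
  have Phs: "P \<subseteq> topspace (half_space n)" by (auto simp: P_def W'_def)
  have ne: "W \<inter> manifold_interior n Z \<noteq> {}"
  proof -
    obtain d where d: "d > 0" "ball 0 d \<subseteq> K 0" using K(1,3)[of 0] c(2) openE by metis
    let ?x = "c(0 := d/2)"
    have "d/2 \<in> K 0" using d by (intro subsetD[OF d(2)]) auto
    then have "?x \<in> P" using d(1) c K(3) n by (auto simp: P_def W'_def PiE_iff topspace_half_space)
    then have "\<phi> (\<theta> ?x) \<in> P" "\<theta> ?x \<in> U" using inv(2) \<theta>U Phs by auto
    then show ?thesis unfolding Wint by blast
  qed
  have sc: "simply_connected_space (subtopology Z (W \<inter> manifold_interior n Z))"
  proof (rule simply_connected_space_homeomorphic_maps)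
    have "P \<subseteq> topspace (Euclidean_space n)"
      using Phs by (auto simp: topspace_half_space topspace_Euclidean_space)
    then show "simply_connected_space (subtopology (Euclidean_space n) P)"
    proof (rule simply_connected_space_convex_Euclidean)
      fix x y and t :: real assume xy: "x \<in> P" "y \<in> P" and t: "t \<in> {0..1}"
      have "(1 - t) * x i + t * y i \<in> K i" for i
        using convexD_alt[OF K(2), of "x i" i "y i" t] xy t by (auto simp: P_def W'_def PiE_iff)
      moreover have "0 < (1 - t) * x 0 + t * y 0"
        using convexD_alt[of "{0::real<..}" "x 0" "y 0" t] xy t by (auto simp: P_def)
      ultimately show "(\<lambda>i. (1 - t) * x i + t * y i) \<in> P"
        using xy by (auto simp: P_def W'_def PiE_iff topspace_half_space)
    qed
    have "homeomorphic_maps (subtopology (subtopology Z U) {w. \<phi> w \<in> P}) (subtopology (half_space n) P) \<phi> \<theta>"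
      using hom
    proof (rule homeomorphic_maps_subtopologies)
      have surj: "\<phi> ` topspace (subtopology Z U) = topspace (half_space n)"
        using hom homeomorphic_imp_surjective_map homeomorphic_maps_map by blast
      show "\<phi> ` (topspace (subtopology Z U) \<inter> {w. \<phi> w \<in> P}) = topspace (half_space n) \<inter> P"
        unfolding surj[symmetric] by auto
    qed
    moreover have "subtopology (subtopology Z U) {w. \<phi> w \<in> P} = subtopology Z (W \<inter> manifold_interior n Z)"
      unfolding Wint by (simp add: subtopology_subtopology Int_def)
    moreover have "{x. 0 \<le> x 0} \<inter> P = P" by (auto simp: P_def)
    then have "subtopology (half_space n) P = subtopology (Euclidean_space n) P"
      by (simp add: half_space_def subtopology_subtopology)
    ultimately show "homeomorphic_maps (subtopology (Euclidean_space n) P) 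
        (subtopology Z (W \<inter> manifold_interior n Z)) \<theta> \<phi>"
      using homeomorphic_maps_sym by metis
  qed
  show thesis using W zW WV ne sc by (rule that)
qed

section \<open>Maps between manifolds\<close>

lemma topological_immersion_imp_locally_injective:
  assumes "topological_immersion A B g"
  shows "locally_injective A g"
  unfolding locally_injective_def
proof
  fix a assume "a \<in> topspace A"
  then obtain U where U: "openin A U" "a \<in> U" "homeomorphic_map (subtopology A U) (subtopology B (g ` U)) g"
    using assms by (auto simp: topological_immersion_def)
  then have "inj_on g (topspace (subtopology A U))"
    using homeomorphic_imp_injective_map by blast
  moreover have "topspace (subtopology A U) = U" using U(1) openin_subset by fastforce
  ultimately show "\<exists>U. openin A U \<and> a \<in> U \<and> inj_on g U" using U by auto
qed

text \<open>Near a point sent to the boundary, \<open>g\<close> followed by a half-space chart would be an injective map from a locally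
  Euclidean space into the half-space that reaches the bounding hyperplane.\<close>

lemma locally_Euclidean_image_subset_interior:
  assumes A: "manifold_interior n A = topspace A" and Y: "topological_manifold n Y"
    and g: "continuous_map A Y g" "locally_injective A g"
  shows "g ` topspace A \<subseteq> manifold_interior n Y"
proof (rule ccontr)
  assume "\<not> ?thesis"
  then obtain a where a: "a \<in> topspace A" "g a \<notin> manifold_interior n Y" by blast
  then have "g a \<in> manifold_boundary n Y"
    using continuous_map_image_subset_topspace[OF g(1)] by (auto simp: manifold_boundary_def)
  then obtain U \<phi> \<theta> where n: "n > 0" and U: "openin Y U" "g a \<in> U"
    and hom: "homeomorphic_maps (subtopology Y U) (half_space n) \<phi> \<theta>"
    and bd: "\<And>w. w \<in> U \<Longrightarrow> w \<in> manifold_boundary n Y \<longleftrightarrow> \<phi> w 0 = 0"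
    using manifold_boundary_chart[OF Y] by metis
  obtain M where M: "openin A M" "a \<in> M" "inj_on g M"
    using g(2) a(1) by (auto simp: locally_injective_def)
  define N where "N = M \<inter> {w \<in> topspace A. g w \<in> U}"
  have N: "openin A N"
    unfolding N_def using M(1) openin_continuous_map_preimage[OF g(1) U(1)] by blast
  have UY: "U \<subseteq> topspace Y" using U(1) openin_subset by blast
  have \<phi>: "continuous_map (subtopology Y U) (half_space n) \<phi>" and inv: "\<And>x. x \<in> U \<Longrightarrow> \<theta> (\<phi> x) = x"
    using hom UY unfolding homeomorphic_maps_def by auto
  have "continuous_map (subtopology A N) (subtopology Y U) g"
    using g(1) by (auto simp: continuous_map_in_subtopology continuous_map_from_subtopology N_def)
  then have c: "continuous_map (subtopology A N) (half_space n) (\<phi> \<circ> g)"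
    using \<phi> by (rule continuous_map_compose)
  have "inj_on \<phi> (g ` N)"
    using inv by (intro inj_on_inverseI[where g = \<theta>]) (auto simp: N_def)
  then have i: "inj_on (\<phi> \<circ> g) N"
    using M(3) by (intro comp_inj_on) (auto simp: N_def inj_on_def)
  have "N \<subseteq> manifold_interior n A" using A N openin_subset by blast
  then have "0 < (\<phi> \<circ> g) a 0"
    using half_space_image_of_locally_Euclidean[OF N _ n c i] M(2) U(2) a(1) by (simp add: N_def)
  moreover have "\<phi> (g a) 0 = 0" using bd U(2) \<open>g a \<in> manifold_boundary n Y\<close> by blast
  ultimately show False by simp
qed

lemma manifold_interior_dense:
  assumes Z: "topological_manifold n Z"
  shows "Z closure_of manifold_interior n Z = topspace Z"
proof
  show "topspace Z \<subseteq> Z closure_of manifold_interior n Z"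
  proof
    fix z assume z: "z \<in> topspace Z"
    show "z \<in> Z closure_of manifold_interior n Z"
    proof (cases "z \<in> manifold_interior n Z")
      case True
      then show ?thesis using closure_of_subset[OF manifold_interior_subset[of n Z]] by blast
    next
      case False
      then have zb: "z \<in> manifold_boundary n Z" using z by (simp add: manifold_boundary_def)
      have "\<exists>y. y \<in> manifold_interior n Z \<and> y \<in> T" if T: "z \<in> T" "openin Z T" for T
      proof -
        obtain W where "W \<subseteq> T" "W \<inter> manifold_interior n Z \<noteq> {}"
          by (rule manifold_boundary_simply_connected_nbhd[OF Z zb T(2,1)])
        then show ?thesis by blast
      qed
      then show ?thesis using z by (auto simp: in_closure_of)
    qed
  qed
qed (rule closure_of_subset_topspace)

lemma simply_connected_imp_connectedin:
  assumes "simply_connected_space (subtopology X S)" "S \<subseteq> topspace X"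
  shows "connectedin X S"
  using assms path_connected_imp_connected_space
  by (auto simp: simply_connected_space_def connectedin_def)

text \<open>If the interior split into two open parts, their closures would cover \<open>Z\<close> and hence meet, necessarily
  in a boundary point. But that point has a neighbourhood whose interior part is connected.\<close>

lemma connected_space_manifold_interior:
  assumes Z: "topological_manifold n Z" "connected_space Z"
  shows "connected_space (subtopology Z (manifold_interior n Z))"
proof (rule ccontr)
  let ?I = "manifold_interior n Z"
  have IZ: "?I \<subseteq> topspace Z" by (rule manifold_interior_subset)
  assume "\<not> ?thesis"
  then obtain E1 E2 where E: "openin (subtopology Z ?I) E1" "openin (subtopology Z ?I) E2"
      "E1 \<union> E2 = topspace (subtopology Z ?I)" "E1 \<inter> E2 = {}" "E1 \<noteq> {}" "E2 \<noteq> {}"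
    unfolding connected_space_eq by blast
  have op: "openin Z E1" "openin Z E2"
    using E(1,2) by (auto simp: openin_open_subtopology openin_manifold_interior)
  have un: "E1 \<union> E2 = ?I" using E(3) IZ by auto
  have "Z closure_of E1 \<inter> Z closure_of E2 = {}"
  proof (rule ccontr)
    assume "\<not> ?thesis"
    then obtain z where z: "z \<in> Z closure_of E1" "z \<in> Z closure_of E2" by blast
    have meets: "T \<inter> E1 \<noteq> {}" "T \<inter> E2 \<noteq> {}" if "openin Z T" "z \<in> T" for T
      using z that by (auto simp: in_closure_of)
    have "z \<notin> E1" "z \<notin> E2" using meets op E(4) by blast+
    moreover have "z \<in> topspace Z" using z by (simp add: in_closure_of)
    ultimately have "z \<in> manifold_boundary n Z" using un by (auto simp: manifold_boundary_def)
    then obtain W where W: "openin Z W" "z \<in> W" 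
        and sc: "simply_connected_space (subtopology Z (W \<inter> ?I))"
      using manifold_boundary_simply_connected_nbhd[OF Z(1) _ openin_topspace \<open>z \<in> topspace Z\<close>] by metis
    have "connectedin Z (W \<inter> ?I)"
      using sc IZ by (intro simply_connected_imp_connectedin) auto
    moreover have "W \<inter> ?I \<subseteq> E1 \<union> E2" "E1 \<inter> E2 \<inter> (W \<inter> ?I) = {}" using un E(4) by auto
    moreover have "E1 \<inter> (W \<inter> ?I) \<noteq> {}" "E2 \<inter> (W \<inter> ?I) \<noteq> {}"
      using meets[OF W] un by auto
    ultimately show False using op unfolding connectedin by blast
  qed
  moreover have "Z closure_of E1 \<union> Z closure_of E2 = topspace Z"
    using manifold_interior_dense[OF Z(1)] un by (metis closure_of_Un)
  moreover have "Z closure_of E1 \<noteq> {}" "Z closure_of E2 \<noteq> {}"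
    using E(5,6) closure_of_subset[of E1 Z] closure_of_subset[of E2 Z] op[THEN openin_subset] by blast+
  ultimately show False
    using Z(2) closedin_closure_of unfolding connected_space_closedin_eq by metis
qed

section \<open>Fibres and components\<close>

text \<open>The points with at least two preimages form an open set, since disjoint neighbourhoods of two
  preimages have open images; the points with at most one preimage form an open set because \<open>p\<close> is
  closed and locally injective. By connectedness one of these sets is empty, and the fibre over \<open>b\<close> decides which.\<close>

lemma proper_local_homeo_inj_if_singleton_fibre:
  assumes E: "Hausdorff_space E" and B: "connected_space B"
    and p: "continuous_map E B p" "proper_map E B p" "open_map E B p" "locally_injective E p"
    and b: "b \<in> topspace B" "\<And>d e. d \<in> topspace E \<Longrightarrow> e \<in> topspace E \<Longrightarrow> p d = b \<Longrightarrow> p e = b \<Longrightarrow> d = e"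
  shows "inj_on p (topspace E)"
proof -
  define D where "D = {y. \<exists>d\<in>topspace E. \<exists>e\<in>topspace E. d \<noteq> e \<and> p d = y \<and> p e = y}"
  have pB: "p e \<in> topspace B" if "e \<in> topspace E" for e
    using continuous_map_image_subset_topspace[OF p(1)] that by blast
  have "openin B D"
  proof (subst openin_subopen, intro ballI)
    fix y assume "y \<in> D"
    then obtain d e where de: "d \<in> topspace E" "e \<in> topspace E" "d \<noteq> e" "p d = y" "p e = y"
      by (auto simp: D_def)
    then obtain U V where UV: "openin E U" "openin E V" "d \<in> U" "e \<in> V" "disjnt U V"
      using E[unfolded Hausdorff_space_def, rule_format, of d e] by (meson de(1-3))
    have "openin B (p ` U \<inter> p ` V)" using p(3) UV by (auto simp: open_map_def)
    moreover have "y \<in> p ` U \<inter> p ` V" using de(4,5) UV(3,4) by (metis IntI imageI)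
    moreover have "p ` U \<inter> p ` V \<subseteq> D"
    proof
      fix y assume "y \<in> p ` U \<inter> p ` V"
      then obtain u v where "u \<in> U" "v \<in> V" "p u = y" "p v = y" by (metis Int_iff imageE)
      moreover have "u \<noteq> v" using UV(5) calculation by (auto simp: disjnt_def)
      moreover have "u \<in> topspace E" "v \<in> topspace E" using calculation UV openin_subset by blast+
      ultimately show "y \<in> D" unfolding D_def by blast
    qed
    ultimately show "\<exists>T. openin B T \<and> y \<in> T \<and> T \<subseteq> D" by blast
  qed
  moreover have "openin B (topspace B - D)"
  proof (subst openin_subopen, intro ballI)
    fix y assume y: "y \<in> topspace B - D"
    obtain U where U: "openin E U" "inj_on p U" "{e \<in> topspace E. p e = y} \<subseteq> U"
    proof (cases "{e \<in> topspace E. p e = y} = {}")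
      case True
      then show thesis using that[of "{}"] by auto
    next
      case False
      then obtain e where e: "e \<in> topspace E" "p e = y" by blast
      then obtain U where U: "openin E U" "e \<in> U" "inj_on p U"
        using p(4) unfolding locally_injective_def by blast
      moreover have "{e \<in> topspace E. p e = y} \<subseteq> {e}" using y e by (auto simp: D_def)
      ultimately show thesis using that by blast
    qed
    obtain V where V: "openin B V" "y \<in> V" "{e \<in> topspace E. p e \<in> V} \<subseteq> U"
      using p(2) U y unfolding proper_map_def closed_map_fibre_neighbourhood by (meson DiffD1)
    have "V \<subseteq> topspace B - D"
    proof
      fix v assume v: "v \<in> V"
      have "v \<notin> D"
      proof
        assume "v \<in> D"
        then obtain d e where "d \<in> topspace E" "e \<in> topspace E" "d \<noteq> e" "p d = v" "p e = v"
          by (auto simp: D_def)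
        moreover have "d \<in> U" "e \<in> U" using calculation v V(3) by auto
        ultimately show False using U(2) by (auto simp: inj_on_def)
      qed
      then show "v \<in> topspace B - D" using v V(1) openin_subset by blast
    qed
    then show "\<exists>T. openin B T \<and> y \<in> T \<and> T \<subseteq> topspace B - D" using V by blast
  qed
  moreover have "D \<subseteq> topspace B" using pB by (auto simp: D_def)
  ultimately have "closedin B D" by (simp add: closedin_def)
  have "b \<notin> D" using b(2) by (auto simp: D_def)
  then have "D = {}" using B b(1) \<open>openin B D\<close> \<open>closedin B D\<close> unfolding connected_space_clopen_in by blast
  then show ?thesis by (auto simp: inj_on_def D_def)
qed

lemma proper_local_homeo_onto_connected:
  assumes B: "connected_space B" and p: "closed_map E B p" "open_map E B p" and ne: "topspace E \<noteq> {}"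
  shows "p ` topspace E = topspace B"
proof -
  have "openin B (p ` topspace E)" "closedin B (p ` topspace E)"
    using p by (auto simp: open_map_def closed_map_def)
  then show ?thesis using B ne unfolding connected_space_clopen_in by blast
qed

lemma finite_connected_components_of_compact:
  assumes "compact_space P" "locally_connected_space P"
  shows "finite (connected_components_of P)"
proof -
  have "\<And>C. C \<in> connected_components_of P \<Longrightarrow> openin P C"
    using assms(2) by (rule openin_connected_components_of_locally_connected_space)
  then obtain \<F> where \<F>: "finite \<F>" "\<F> \<subseteq> connected_components_of P" "topspace P \<subseteq> \<Union>\<F>"
    using assms(1) Union_connected_components_of[of P]
    unfolding compact_space_alt by (metis order_refl)
  have "connected_components_of P \<subseteq> \<F>"
  proof
    fix C assume C: "C \<in> connected_components_of P"
    then obtain c where c: "c \<in> C" using nonempty_connected_components_of by blast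
    then obtain C' where C': "C' \<in> \<F>" "c \<in> C'" using \<F>(3) connected_components_of_subset[OF C] by blast
    then have "C = C'"
      using pairwise_disjoint_connected_components_of[of P] C c \<F>(2) unfolding pairwise_def disjnt_def by blast
    then show "C \<in> \<F>" using C' by simp
  qed
  then show ?thesis using \<F>(1) finite_subset by blast
qed

text \<open>The map induced on components is a surjection between finite sets of equal size, hence injective.\<close>

lemma connected_component_of_reflects:
  assumes P: "compact_space P" "locally_connected_space P"
    and eq: "connected_components_of P \<approx> connected_components_of Q"
    and f: "continuous_map P Q f" "f ` topspace P = topspace Q"
    and x: "x \<in> topspace P" "x' \<in> topspace P" "connected_component_of Q (f x) (f x')"
  shows "connected_component_of P x x'"
proof -
  \<comment> \<open>The choice of \<open>c\<close> is immaterial, as \<open>f\<close> maps each component into a single one.\<close>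
  define \<Phi> where "\<Phi> C = connected_component_of_set Q (f (SOME c. c \<in> C))" for C
  have \<Phi>: "\<Phi> (connected_component_of_set P a) = connected_component_of_set Q (f a)" if "a \<in> topspace P" for a
  proof -
    have "connected_component_of P a a" using that by (simp add: connected_component_of_refl)
    then have "connected_component_of P a (SOME c. c \<in> connected_component_of_set P a)"
      using someI[of "\<lambda>c. c \<in> connected_component_of_set P a" a] by simp
    then have "connected_component_of Q (f a) (f (SOME c. c \<in> connected_component_of_set P a))"
      by (rule connected_component_of_continuous_image[OF f(1)])
    then show ?thesis unfolding \<Phi>_def by (metis connected_component_of_equiv)
  qed
  have "\<Phi> ` connected_components_of P = connected_components_of Q"
    using \<Phi> f(2)[symmetric] by (auto simp: connected_components_of_def image_image cong: image_cong)
  moreover have "finite (connected_components_of P)"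
    using P by (rule finite_connected_components_of_compact)
  moreover have "card (connected_components_of P) = card (connected_components_of Q)"
    using eq unfolding eqpoll_def using bij_betw_same_card by blast
  ultimately have "inj_on \<Phi> (connected_components_of P)"
    using eq_card_imp_inj_on by metis
  moreover have "\<Phi> (connected_component_of_set P x) = \<Phi> (connected_component_of_set P x')"
    using x \<Phi> by (metis connected_component_of_equiv)
  ultimately have "connected_component_of_set P x = connected_component_of_set P x'"
    using x by (simp add: inj_on_def connected_component_in_connected_components_of)
  moreover have "x' \<in> connected_component_of_set P x'" using x by (simp add: connected_component_of_refl)
  ultimately show ?thesis by blast
qed

text \<open>By the preceding lemma two points over \<open>C\<close> are joined by a path in \<open>P\<close>, whose image stays in \<open>C\<close>; if
  they have the same image, that image path is a loop, and the monodromy lemma applies.\<close>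

lemma simply_connected_component_inj:
  assumes P: "compact_space P" "locally_path_connected_space P" "Hausdorff_space P"
    and eq: "connected_components_of P \<approx> connected_components_of Q"
    and f: "continuous_map P Q f" "proper_map P Q f" "open_map P Q f" "locally_injective P f"
    and surj: "f ` topspace P = topspace Q"
    and C: "C \<in> connected_components_of Q" "simply_connected_space (subtopology Q C)"
    and x: "x \<in> topspace P" "x' \<in> topspace P" "f x \<in> C" "f x' = f x"
  shows "x = x'"
proof -
  have "f x \<in> topspace Q" using x(1) surj by blast
  then have "connected_component_of Q (f x) (f x')"
    using x(4) by (simp add: connected_component_of_refl)
  then have "connected_component_of P x x'"
    using connected_component_of_reflects[OF P(1) _ eq f(1) surj x(1,2)] P(2)
      locally_path_connected_imp_locally_connected_space by blast
  then have "path_component_of P x x'"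
    using path_component_eq_connected_component_of[OF P(2), of x] by blast
  then obtain \<gamma> where \<gamma>: "pathin P \<gamma>" "\<gamma> 0 = x" "\<gamma> 1 = x'"
    by (auto simp: path_component_of_def)
  have "connectedin P (\<gamma> ` {0..1})"
    using path_connectedin_imp_connectedin path_connectedin_path_image \<gamma>(1) by blast
  then have "connectedin Q (f ` \<gamma> ` {0..1})"
    by (rule connectedin_continuous_map_image[OF f(1)])
  moreover have "f x \<in> f ` \<gamma> ` {0..1}" using \<gamma>(2) by force
  then have "\<not> disjnt C (f ` \<gamma> ` {0..1})" using x(3) by (auto simp: disjnt_def)
  ultimately have "f ` \<gamma> ` {0..1} \<subseteq> C"
    by (rule connected_components_of_maximal[OF C(1)])
  then have "\<gamma> 0 = \<gamma> 1"
    using proper_local_homeo_monodromy[OF P(3) f C(2) \<gamma>(1)] \<gamma>(2,3) x(4) by simp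
  then show ?thesis using \<gamma> by simp
qed

section \<open>The homeomorphism theorem\<close>

theorem theorem1p7:
  fixes X :: "'a topology" and Y :: "'b topology" and f :: "'a \<Rightarrow> 'b" and n :: nat
  assumes "topological_manifold n X" and "connected_space X" and "compact_space X"
    and "topological_manifold n Y" and "connected_space Y"
    and "continuous_map X Y f"
    and "f ` manifold_boundary n X \<subseteq> manifold_boundary n Y"
    and "topological_immersion (subtopology X (manifold_boundary n X)) Y f"
    and "topological_immersion (subtopology X (topspace X - manifold_boundary n X)) Y f"
    and "manifold_boundary n X \<noteq> {}" and "manifold_boundary n Y \<noteq> {}"
    and "connected_components_of (subtopology X (manifold_boundary n X)) \<approx>
         connected_components_of (subtopology Y (manifold_boundary n Y))"
    and "\<exists>C \<in> connected_components_of (subtopology Y (manifold_boundary n Y)).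
           simply_connected_space (subtopology Y C)"
  shows "homeomorphic_map X Y f"
proof -
  let ?IX = "manifold_interior n X" and ?IY = "manifold_interior n Y"
  let ?bX = "manifold_boundary n X" and ?bY = "manifold_boundary n Y"
  let ?A = "subtopology X ?IX" and ?B = "subtopology Y ?IY"
  let ?P = "subtopology X ?bX" and ?Q = "subtopology Y ?bY"
  note X = assms(1) and Y = assms(4) and cont = assms(6)
  have HX: "Hausdorff_space X" and HY: "Hausdorff_space Y"
    using X Y by (auto simp: topological_manifold_def)
  have splitX: "topspace X = ?IX \<union> ?bX" "?IX \<inter> ?bX = {}" and splitY: "topspace Y = ?IY \<union> ?bY" "?IY \<inter> ?bY = {}"
    by (auto simp: manifold_boundary_def manifold_interior_def)
  have "topspace X - ?bX = ?IX" using splitX by blast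
  then have immI: "topological_immersion ?A Y f" using assms(9) by simp
  have IA: "manifold_interior n ?A = topspace ?A" by (rule manifold_interior_interior)
  have IB: "manifold_interior n ?B = topspace ?B" by (rule manifold_interior_interior)
  have topA: "topspace ?A = ?IX" and topB: "topspace ?B = ?IY" and topP: "topspace ?P = ?bX" and topQ: "topspace ?Q = ?bY"
    using splitX splitY by auto

  have "continuous_map ?A Y f" using immI by (simp add: topological_immersion_def)
  then have fI: "f ` ?IX \<subseteq> ?IY"
    using locally_Euclidean_image_subset_interior[OF IA Y _ topological_immersion_imp_locally_injective[OF immI]]
    unfolding topA by blast
  have fb: "f ` ?bX \<subseteq> ?bY" by (fact assms(7))

  have A: "continuous_map ?A ?B f"
    using \<open>continuous_map ?A Y f\<close> fI topA by (auto simp: continuous_map_in_subtopology)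
  have P: "continuous_map ?P ?Q f"
    using assms(8) fb topP by (auto simp: continuous_map_in_subtopology topological_immersion_def)
  have Ai: "locally_injective ?A f" using immI by (rule topological_immersion_imp_locally_injective)
  have Pi: "locally_injective ?P f" using assms(8) by (rule topological_immersion_imp_locally_injective)
  have Ao: "open_map ?A ?B f" using IA IB A Ai by (rule locally_Euclidean_locally_injective_imp_open_map)
  have Po: "open_map ?P ?Q f"
    using manifold_interior_boundary[OF X] manifold_interior_boundary[OF Y] P Pi
    by (rule locally_Euclidean_locally_injective_imp_open_map)
  have proper: "proper_map X Y f"
    using assms(3) Hausdorff_imp_kc_space[OF HY] cont by (rule continuous_imp_proper_map)
  then have closed: "closed_map X Y f" by (rule proper_imp_closed_map)
  have Ap: "proper_map ?A ?B f"
    using proper by (rule proper_map_restriction) (use fI fb splitX splitY in auto)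
  have Pp: "proper_map ?P ?Q f"
    using proper by (rule proper_map_restriction) (use fI fb splitX splitY in auto)
  have HA: "Hausdorff_space ?A" and HP: "Hausdorff_space ?P"
    using HX by (auto intro: Hausdorff_space_subtopology)
  have B_conn: "connected_space ?B" using Y assms(5) by (rule connected_space_manifold_interior)

  have "X closure_of ?IX \<noteq> {}" using manifold_interior_dense[OF X] assms(10) splitX by auto
  then have "topspace ?A \<noteq> {}" unfolding topA by (metis closure_of_empty)
  then have fI_onto: "f ` ?IX = ?IY"
    using proper_local_homeo_onto_connected[OF B_conn proper_imp_closed_map[OF Ap] Ao] topA topB by simp
  have "closedin Y (f ` topspace X)" using closed by (simp add: closed_map_def)
  then have "Y closure_of ?IY \<subseteq> f ` topspace X"
    using fI_onto splitX by (intro closure_of_minimal) auto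
  then have onto: "f ` topspace X = topspace Y"
    using manifold_interior_dense[OF Y] continuous_map_image_subset_topspace[OF cont] by auto
  have fb_onto: "f ` ?bX = ?bY"
  proof
    show "?bY \<subseteq> f ` ?bX"
    proof
      fix y assume y: "y \<in> ?bY"
      then obtain x where x: "x \<in> topspace X" "y = f x" using onto splitY by blast
      then have "x \<notin> ?IX" using fI y splitY by blast
      then show "y \<in> f ` ?bX" using x splitX by blast
    qed
  qed (fact fb)

  obtain C where C: "C \<in> connected_components_of ?Q" "simply_connected_space (subtopology Y C)"
    using assms(13) by blast
  have CQ: "C \<subseteq> ?bY" using connected_components_of_subset[OF C(1)] topQ by blast
  then have C_sc: "simply_connected_space (subtopology ?Q C)"
    using C(2) by (simp add: subtopology_subtopology Int_absorb1)
  obtain y where y: "y \<in> C" using nonempty_connected_components_of[OF C(1)] by blast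
  then have yb: "y \<in> ?bY" using CQ by (rule subsetD[rotated])
  then have "y \<in> f ` ?bX" unfolding fb_onto .
  then obtain x where x: "x \<in> ?bX" "f x = y" by (elim imageE) simp
  have "closedin X ?bX"
    using openin_manifold_interior[of X n] by (auto simp: manifold_boundary_def)
  then have "compact_space ?P"
    using assms(3) closedin_compact_space compact_space_subtopology by blast
  moreover have "locally_path_connected_space ?P"
    using manifold_interior_boundary[OF X] by (rule locally_path_connected_space_if_locally_Euclidean)
  ultimately have fibre_P: "w = x" if "w \<in> ?bX" "f w = y" for w
    using simply_connected_component_inj[OF _ _ HP assms(12) P Pp Po Pi _ C(1) C_sc, of w x] fb_onto
      topP topQ that x y splitX(1) by simp
  have fibre: "{w \<in> topspace X. f w = y} \<subseteq> {x}"
    using fibre_P fI splitX splitY CQ y by blast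

  \<comment> \<open>An interior point \<open>b\<close> close to \<open>y\<close> has one interior preimage: all its preimages lie in a small
    half-ball \<open>U\<close> at \<open>x\<close>, and paths in its interior part have images in the simply connected interior part of \<open>W0\<close>. The
    set \<open>V\<close> has to be chosen after \<open>U\<close>, and \<open>U\<close> after \<open>W0\<close>.\<close>
  obtain W0 where W0: "openin Y W0" "y \<in> W0" "simply_connected_space (subtopology Y (W0 \<inter> ?IY))"
  proof -
    have "y \<in> ?bY" "y \<in> topspace Y" using y CQ splitY by auto
    then show ?thesis
      using manifold_boundary_simply_connected_nbhd[OF Y _ openin_topspace] that by metis
  qed
  obtain U where U: "openin X U" "x \<in> U" "U \<subseteq> {w \<in> topspace X. f w \<in> W0}"
      "simply_connected_space (subtopology X (U \<inter> ?IX))"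
  proof -
    have "x \<in> {w \<in> topspace X. f w \<in> W0}" using x W0(2) splitX by auto
    then show ?thesis
      using manifold_boundary_simply_connected_nbhd[OF X x(1) openin_continuous_map_preimage[OF cont W0(1)]] that
      by metis
  qed
  have "{w \<in> topspace X. f w = y} \<subseteq> U" using fibre U(2) by blast
  then obtain V where V: "openin Y V" "y \<in> V" "{w \<in> topspace X. f w \<in> V} \<subseteq> U"
  proof -
    have "y \<in> topspace Y" using yb splitY by blast
    then show ?thesis
      using closed U(1) \<open>{w \<in> topspace X. f w = y} \<subseteq> U\<close> that
      unfolding closed_map_fibre_neighbourhood by meson
  qed
  obtain b where b: "b \<in> V" "b \<in> ?IY"
  proof -
    have "y \<in> ?bY" using y CQ by auto
    then obtain W where "W \<subseteq> V" "W \<inter> ?IY \<noteq> {}"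
      using manifold_boundary_simply_connected_nbhd[OF Y _ V(1,2)] by metis
    then show ?thesis using that by blast
  qed
  have fibre_b: "d = e" if de: "d \<in> ?IX" "e \<in> ?IX" "f d = b" "f e = b" for d e
  proof -
    have "d \<in> topspace (subtopology X (U \<inter> ?IX))" "e \<in> topspace (subtopology X (U \<inter> ?IX))"
      using de V(3) b(1) splitX by auto
    then obtain \<gamma> where \<gamma>: "pathin (subtopology X (U \<inter> ?IX)) \<gamma>" "\<gamma> 0 = d" "\<gamma> 1 = e"
      using U(4) unfolding simply_connected_space_def path_connected_space_def by meson
    have "pathin X \<gamma>" and \<gamma>U: "\<gamma> ` {0..1} \<subseteq> U \<inter> ?IX"
      using \<gamma>(1) by (auto simp: pathin_def continuous_map_in_subtopology)
    then have "pathin ?A \<gamma>" by (auto simp: pathin_def continuous_map_in_subtopology)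
    moreover have "f ` \<gamma> ` {0..1} \<subseteq> W0 \<inter> ?IY" using \<gamma>U U(3) fI by blast
    moreover have "?IY \<inter> (W0 \<inter> ?IY) = W0 \<inter> ?IY" by blast
    then have "simply_connected_space (subtopology ?B (W0 \<inter> ?IY))"
      using W0(3) by (simp add: subtopology_subtopology)
    ultimately show ?thesis
      using proper_local_homeo_monodromy[OF HA A Ap Ao Ai] \<gamma>(2,3) de by metis
  qed
  have injI: "inj_on f ?IX"
    using proper_local_homeo_inj_if_singleton_fibre[OF HA B_conn A Ap Ao Ai, of b] b(2) fibre_b topA topB splitY(1) by simp
  then have "homeomorphic_map ?A ?B f"
    using A Ao fI_onto topA topB by (simp add: bijective_open_imp_homeomorphic_map)
  then obtain g where "homeomorphic_maps ?A ?B f g" by (auto simp: homeomorphic_map_maps)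
  then have gcont: "continuous_map ?B ?A g" and gf: "\<And>u. u \<in> ?IX \<Longrightarrow> g (f u) = u"
    and fg: "\<And>v. v \<in> ?IY \<Longrightarrow> f (g v) = v"
    unfolding homeomorphic_maps_def topA topB by auto
  have gI: "g v \<in> ?IX \<and> f (g v) = v" if "v \<in> ?IY" for v
    using that fg continuous_map_image_subset_topspace[OF gcont] unfolding topA topB by auto

  have injb: "x1 = x2" if x12: "x1 \<in> ?bX" "x2 \<in> ?bX" "f x1 = f x2" for x1 x2
  proof (rule ccontr)
    assume ne: "x1 \<noteq> x2"
    let ?F = "{w \<in> topspace X. f w = f x1}"
    have y': "f x1 \<in> ?bY" using x12(1) fb by blast
    have Fb: "?F \<subseteq> ?bX"
    proof
      fix w assume w: "w \<in> ?F"
      then have "f w \<notin> ?IY" using y' splitY(2) by auto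
      then have "w \<notin> ?IX" using fI by blast
      then show "w \<in> ?bX" using w splitX(1) by blast
    qed
    obtain M where M: "openin ?P M" "x1 \<in> M" "inj_on f M"
      using Pi x12(1) topP unfolding locally_injective_def by blast
    obtain N where N: "openin X N" "M = N \<inter> ?bX" using M(1) by (auto simp: openin_subtopology)
    have "compactin X ?F" using proper y' splitY by (auto simp: proper_map_def)
    \<comment> \<open>Local injectivity isolates \<open>x1\<close> in its fibre, so it can be separated from the remaining points.\<close>
    then have "closedin X (?F - N)"
      using N(1) compactin_imp_closedin[OF HX] closedin_diff by blast
    then have "compactin X (?F - N)"
      using assms(3) by (rule closedin_compact_space[rotated])
    moreover have "disjnt {x1} (?F - N)" using M(2) N(2) by (auto simp: disjnt_def)
    moreover have "compactin X {x1}" using x12(1) splitX(1) by simp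
    ultimately obtain U1 U2 where U12: "openin X U1" "openin X U2" "{x1} \<subseteq> U1" "?F - N \<subseteq> U2" "disjnt U1 U2"
      using Hausdorff_space_compact_separation[OF HX, of "{x1}" "?F - N"] by metis
    have FN: "w = x1" if "w \<in> ?F" "w \<in> N" for w
    proof -
      have "w \<in> M" "f w = f x1" using that Fb N(2) by auto
      then show ?thesis using M(2,3) by (auto dest: inj_onD)
    qed
    have "?F \<subseteq> U1 \<union> U2"
    proof
      fix w assume "w \<in> ?F"
      then show "w \<in> U1 \<union> U2" using FN U12(3,4) by (cases "w \<in> N") blast+
    qed
    moreover have "x2 \<in> ?F" using x12(2,3) splitX(1) by simp
    then have "x2 \<in> U2" using FN ne U12(4) by blast
    ultimately have F: "?F \<subseteq> U1 \<union> U2" "x2 \<in> U2" by this+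
    have "openin X (U1 \<union> U2)" "f x1 \<in> topspace Y" using U12(1,2) y' splitY by auto
    then obtain T where T: "openin Y T" "f x1 \<in> T" "{w \<in> topspace X. f w \<in> T} \<subseteq> U1 \<union> U2"
      using closed F(1) unfolding closed_map_fibre_neighbourhood by meson
    obtain W where W: "openin Y W" "f x1 \<in> W" "W \<subseteq> T" "simply_connected_space (subtopology Y (W \<inter> ?IY))"
      using manifold_boundary_simply_connected_nbhd[OF Y y' T(1,2)] by metis
    have "connectedin Y (W \<inter> ?IY)"
      using W(4) splitY by (intro simply_connected_imp_connectedin) auto
    then have "connectedin ?B (W \<inter> ?IY)" by (simp add: connectedin_subtopology)
    then have "connectedin ?A (g ` (W \<inter> ?IY))"
      by (rule connectedin_continuous_map_image[OF gcont])
    then have conn: "connectedin X (g ` (W \<inter> ?IY))" by (simp add: connectedin_subtopology)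
    have "g ` (W \<inter> ?IY) \<subseteq> U1 \<union> U2"
    proof
      fix u assume "u \<in> g ` (W \<inter> ?IY)"
      then obtain v where v: "v \<in> W" "v \<in> ?IY" "u = g v" by blast
      then have "u \<in> topspace X" "f u = v" using gI splitX(1) by auto
      then show "u \<in> U1 \<union> U2" using v(1) T(3) W(3) by auto
    qed
    moreover have "U' \<inter> g ` (W \<inter> ?IY) \<noteq> {}" if "openin X U'" "w \<in> U'" "w \<in> ?bX" "f w = f x1" for U' w
    proof -
      have op: "openin X (U' \<inter> {v \<in> topspace X. f v \<in> W})"
        using that(1) openin_continuous_map_preimage[OF cont W(1)] by blast
      have wU: "w \<in> U' \<inter> {v \<in> topspace X. f v \<in> W}" using that W(2) splitX by auto
      have cl: "w \<in> X closure_of ?IX" using manifold_interior_dense[OF X] that(3) splitX by auto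
      have "\<exists>v. v \<in> ?IX \<and> v \<in> U' \<inter> {v \<in> topspace X. f v \<in> W}"
        by (rule cl[unfolded in_closure_of, THEN conjunct2, rule_format, OF conjI[OF wU op]])
      then obtain v where v: "v \<in> ?IX" "v \<in> U'" "f v \<in> W" by blast
      have "f v \<in> W \<inter> ?IY" using v fI by blast
      then have "g (f v) \<in> g ` (W \<inter> ?IY)" by (rule imageI)
      then show ?thesis using gf[OF v(1)] v(2) by auto
    qed
    then have "U1 \<inter> g ` (W \<inter> ?IY) \<noteq> {}" "U2 \<inter> g ` (W \<inter> ?IY) \<noteq> {}"
      using U12(1,2,3) F(2) x12 by (metis insert_subset)+
    moreover have "U1 \<inter> U2 \<inter> g ` (W \<inter> ?IY) = {}" using U12(5) by (auto simp: disjnt_def)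
    ultimately show False using conn U12(1,2) unfolding connectedin by blast
  qed
  have "inj_on f (topspace X)"
  proof (rule inj_onI)
    fix u v assume uv: "u \<in> topspace X" "v \<in> topspace X" "f u = f v"
    have in_IY: "f w \<in> ?IY \<longleftrightarrow> w \<in> ?IX" if "w \<in> topspace X" for w
      using that fI fb splitX(1) splitY(2) by (cases "w \<in> ?IX") auto
    have same: "u \<in> ?IX \<longleftrightarrow> v \<in> ?IX"
      using in_IY[OF uv(1)] in_IY[OF uv(2)] uv(3) by simp
    show "u = v"
    proof (cases "u \<in> ?IX")
      case True
      then have "v \<in> ?IX" using uv same by blast
      then show ?thesis using injI True uv(3) by (auto dest: inj_onD)
    next
      case False
      then have "u \<in> ?bX" using uv splitX by blast
      moreover have "v \<in> ?bX" using False uv same splitX by blast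
      ultimately show ?thesis using injb uv(3) by blast
    qed
  qed
  then show ?thesis
    using continuous_imp_homeomorphic_map[OF cont assms(3) HY onto] by blast
qed

end
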